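(* Let $(T^1,F_1)$ and $(T^2,F_2)$ be rooted trees with sinks over $(Q,\rho)$, and let $M_j:=M(T^j,F_j)$ for $j=1,2$ be the corresponding rooted tree modules. Then $\mathrm{Hom}_\Lambda(M_1,M_2)$ is the $\mathcal K$-span of the set $\{\mathcal H_{\mathcal G}\mid\mathcal G\text{ is a generalized graph map from }M_1\text{ to }M_2\}$.
   Context: Fix a field $\mathcal K$ with $\mathrm{char}(\mathcal K)\neq 2$. Let $Q=(Q_0,Q_1,\varsigma,\varepsilon)$ be a quiver and $\rho$ a set of paths in $Q$ of length at least $2$ that bounds the length of the paths, not lying in the ideal $\langle\rho\rangle$, passing through any vertex. Put $\Lambda:=\mathcal KQ/\langle\rho\rangle$. Finite-dimensional $\Lambda$-modules are identified with finite-dimensional $\mathcal K$-representations of $(Q,\rho)$. A tree is a finite quiver $T=(T_0,T_1,s,t)$ whose underlying undirected graph is connected without cycles. Here rooted trees have a unique sink $\ast$ (the root). For a non-root vertex $n$ there is a unique arrow with source $n$, denoted $a_n$ in $T^1$ and $b_n$ in $T^2$; its target is the parent $\mathsf p(n)$. A quiver morphism is a pair of maps (on vertices and on arrows) commuting with sources and targets. A quiver morphism $F:T\to Q$ is bound, written $F:T\to(Q,\rho)$, if there is no path $p$ in $T$ with $F(p)\in\langle\rho\rangle$; then $(T,F)$ is a tree over $(Q,\rho)$. The rooted tree module $M(T,F)$ has a $\mathcal K$-basis indexed by $T_0$, the basis vector $v_n$ lying at the vertex $F(n)$, and $\gamma\in Q_1$ acts by $\gamma\cdot v_n=\sum_{a\in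 T_1,\ s(a)=n,\ F(a)=\gamma}v_{t(a)}$. Write $\{v_n\}_{n\in T^1_0}$ and $\{w_m\}_{m\in T^2_0}$ for these bases of $M_1$ and $M_2$. Networks. A network consists of a quiver together with a set of undirected edges forming a simple graph on the same vertex set. The pullback network $\mathcal N[1]$ has vertices $\mathcal N[1]_0=\{(n,m)\in T^1_0\times T^2_0\mid F_1(n)=F_2(m)\}$; arrows $\mathcal N[1]_1$: $(a_n,b_m):(n,m)\to(\mathsf p(n),\mathsf p(m))$ whenever $F_1(a_n)=F_2(b_m)$; edges $\mathcal E^1=\{\{(n,m),(n,m')\}\mid m\ne m',\ \mathsf p(m)=\mathsf p(m'),\ F_2(b_m)=F_2(b_{m'})\}$. The 2-covering network $\mathcal N[2]$ has $\mathcal N[2]_l=\mathcal N[1]_l\times\{-1,1\}$ for $l=0,1$ (sources and targets keep the sign) and edges $\mathcal E^2=\{\{(n,m,i),(n,m',-i)\}\mid\{(n,m),(n,m')\}\in\mathcal E^1,\ i\in\{-1,1\}\}$; $\pi:\mathcal N[2]\to\mathcal N[1]$ forgets the sign. A link is an arrow, a formal inverse of an arrow, or an edge. A traversal is a walk along links containing no $\alpha\alpha^{-1}$ as a subwalk (with $(\alpha^{-1})^{-1}=\alpha$ for an arrow and $\alpha^{-1}=\alpha$ for an edge); vertices are traversals of length $0$. A triangle in $\mathcal N[1]$ is an induced subnetwork on three vertices whose total number of arrows and edges is $3$. $\mathcal R[1]$ is the set of length-two traversals in $\mathcal N[1]$ through three vertices inducing a triangle, and $\mathcal R[2]$ is the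 set of traversals $\mathfrak t$ in $\mathcal N[2]$ with $\pi(\mathfrak t)\in\mathcal R[1]$. A subnetwork $\mathcal M=(\mathcal M_0,\mathcal M_1,\mathcal E_{\mathcal M})$ of $\mathcal N[2]$ is: $\mathcal R[2]$-free if no traversal in $\mathcal M$ lies in $\mathcal R[2]$; involution-free if $(n,m,j)\in\mathcal M_0$ implies $(n,m,-j)\notin\mathcal M_0$; connected if there is a traversal in $\mathcal M$ between any two of its vertices; complete if for each $(n,m,j)\in\mathcal M_0$: (i) for every arrow $a_{n'}:n'\to n$ in $T^1$ there is an arrow $b_{m'}:m'\to m$ in $T^2$ such that the arrow $(a_{n'},b_{m'},j):(n',m',j)\to(n,m,j)$ is in $\mathcal M_1$; (ii) if there is an arrow $b_m:m\to m'$ in $T^2$, then at least one of the following holds: there is an arrow $a_n:n\to n'$ in $T^1$ with $(a_n,b_m,j)\in\mathcal M_1$; or there is $b_{m''}:m''\to m'$ in $T^2$ with $F_2(b_m)=F_2(b_{m''})$, $(n,m'',-j)\in\mathcal M_0$ and $\{(n,m,j),(n,m'',-j)\}\in\mathcal E_{\mathcal M}$. A generalized graph map (GGM) from $M_1$ to $M_2$ is a non-empty, complete, connected, $\mathcal R[2]$-free and involution-free subnetwork of $\mathcal N[2]$. The linear map associated with a subnetwork $\mathcal M$ is $\mathcal H_{\mathcal M}:M_1\to M_2$, $\mathcal H_{\mathcal M}(v_n)=\sum_{(n,m,j)\in\mathcal M_0}j\,w_m$. *)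

theory Defs
  imports
    "HOL-Library.Function_Algebras"
    "Graph_Theory.Digraph_Component"
begin

section \<open>Quivers and trees\<close>

text \<open>
  Quivers are the digraphs of the AFP entry \<open>Graph_Theory\<close> satisfying
  \<^const>\<open>wf_digraph\<close>; multiple arrows, loops and infinite vertex or arrow sets are allowed.

  The predicate \<^const>\<open>tree\<close> of that entry only excludes directed cycles, so it is not used
  below.  The underlying undirected (multi)graph of a quiver is encoded by letting every arrow be
  traversed in both directions; an undirected cycle is then a cycle that uses no arrow twice.
\<close>

definition undirected :: "('v, 'a) pre_digraph \<Rightarrow> ('v, 'a \<times> bool) pre_digraph" where
  "undirected T =
    \<lparr> verts = verts T,
      arcs = arcs T \<times> UNIV,
      tail = (\<lambda>(a, forward). if forward then tail T a else head T a),
      head = (\<lambda>(a, forward). if forward then head T a else tail T a) \<rparr>"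

definition quiver_tree :: "('v, 'a) pre_digraph \<Rightarrow> bool" where
  "quiver_tree T \<longleftrightarrow>
     fin_digraph T \<and> connected T \<and>
     \<not> (\<exists>p. pre_digraph.cycle (undirected T) p \<and> distinct (map fst p))"

definition rooted_tree :: "('v, 'a) pre_digraph \<Rightarrow> bool" where
  "rooted_tree T \<longleftrightarrow> quiver_tree T \<and> (\<exists>!r. r \<in> verts T \<and> out_arcs T r = {})"

definition quiver_morphism ::
    "('v, 'a) pre_digraph \<Rightarrow> ('x, 'c) pre_digraph \<Rightarrow> ('v \<Rightarrow> 'x) \<times> ('a \<Rightarrow> 'c) \<Rightarrow> bool" where
  "quiver_morphism T Q F \<longleftrightarrow>
     (\<forall>n\<in>verts T. fst F n \<in> verts Q) \<and>
     (\<forall>a\<in>arcs T. snd F a \<in> arcs Q \<and>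
        tail Q (snd F a) = fst F (tail T a) \<and> head Q (snd F a) = fst F (head T a))"


section \<open>Path algebras\<close>

text \<open>
  A path is a pair of its starting vertex and the list of its arrows, the first arrow to be
  travelled coming first; \<open>(x, [])\<close> is the trivial path at \<open>x\<close>.
  An element of the path algebra is the function sending a path to its coefficient.
\<close>

type_synonym ('x, 'c) path = "'x \<times> 'c list"
type_synonym ('x, 'c, 'k) path_alg = "('x, 'c) path \<Rightarrow> 'k"

definition quiver_paths :: "('x, 'c) pre_digraph \<Rightarrow> ('x, 'c) path set" where
  "quiver_paths Q = {(x, p). \<exists>y. pre_digraph.awalk Q x p y}"

definition scale :: "'k \<Rightarrow> ('i \<Rightarrow> 'k) \<Rightarrow> 'i \<Rightarrow> 'k::times" where
  "scale c f = (\<lambda>i. c * f i)"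

definition basis_vec :: "'i \<Rightarrow> 'i \<Rightarrow> 'k::zero_neq_one" where
  "basis_vec i = (\<lambda>j. of_bool (j = i))"

definition path_algebra :: "('x, 'c) pre_digraph \<Rightarrow> ('x, 'c, 'k::field) path_alg set" where
  "path_algebra Q = {f. finite {p. f p \<noteq> 0} \<and> {p. f p \<noteq> 0} \<subseteq> quiver_paths Q}"

text \<open>
  For paths \<open>p\<close>, \<open>q\<close> the product \<open>p q\<close> is "first \<open>q\<close>, then \<open>p\<close>" if \<open>q\<close> ends where \<open>p\<close> starts,
  and \<open>0\<close> otherwise, so that left modules are (covariant) representations.  The coefficient of a
  product at a path is the sum over all ways of cutting that path in two.
\<close>

definition path_mult :: "('x, 'c) pre_digraph \<Rightarrow>
    ('x, 'c, 'k::field) path_alg \<Rightarrow> ('x, 'c, 'k) path_alg \<Rightarrow> ('x, 'c, 'k) path_alg" where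
  "path_mult Q f g = (\<lambda>(x, r). \<Sum>i\<le>length r.
     f (pre_digraph.awlast Q x (take i r), drop i r) * g (x, take i r))"

definition two_sided_ideal ::
    "('x, 'c) pre_digraph \<Rightarrow> ('x, 'c, 'k::field) path_alg set \<Rightarrow> bool" where
  "two_sided_ideal Q I \<longleftrightarrow>
     I \<subseteq> path_algebra Q \<and> 0 \<in> I \<and>
     (\<forall>a\<in>I. \<forall>b\<in>I. a + b \<in> I) \<and> (\<forall>c. \<forall>a\<in>I. scale c a \<in> I) \<and>
     (\<forall>a\<in>I. \<forall>b\<in>path_algebra Q. path_mult Q a b \<in> I \<and> path_mult Q b a \<in> I)"

definition relation_ideal ::
    "('x, 'c) pre_digraph \<Rightarrow> ('x, 'c) path set \<Rightarrow> ('x, 'c, 'k::field) path_alg set" where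
  "relation_ideal Q \<rho> = \<Inter>{I. two_sided_ideal Q I \<and> basis_vec ` \<rho> \<subseteq> I}"

text \<open>
  The algebra of the bound quiver \<open>(Q, \<rho>)\<close>, as the set of cosets of the relation ideal.
  It has no unit if \<open>Q\<close> has infinitely many vertices.
\<close>

definition bound_quiver_algebra ::
    "('x, 'c) pre_digraph \<Rightarrow> ('x, 'c) path set \<Rightarrow> ('x, 'c, 'k::field) path_alg set set" where
  "bound_quiver_algebra Q \<rho> =
     path_algebra Q //
       {(a, b). a \<in> path_algebra Q \<and> b \<in> path_algebra Q \<and> a - b \<in> relation_ideal Q \<rho>}"

text \<open>The bound on path lengths may depend on the vertex.\<close>

definition relation_set ::
    "'k::field itself \<Rightarrow> ('x, 'c) pre_digraph \<Rightarrow> ('x, 'c) path set \<Rightarrow> bool" where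
  "relation_set _ Q \<rho> \<longleftrightarrow>
     \<rho> \<subseteq> quiver_paths Q \<and> (\<forall>(x, p)\<in>\<rho>. 2 \<le> length p) \<and>
     (\<forall>z\<in>verts Q. \<exists>N. \<forall>(x, p)\<in>quiver_paths Q.
        z \<in> set (pre_digraph.awalk_verts Q x p) \<and>
        (basis_vec (x, p) :: ('x, 'c, 'k) path_alg) \<notin> relation_ideal Q \<rho> \<longrightarrow> length p \<le> N)"

definition bound_morphism :: "'k::field itself \<Rightarrow> ('x, 'c) pre_digraph \<Rightarrow> ('x, 'c) path set \<Rightarrow>
    ('v, 'a) pre_digraph \<Rightarrow> ('v \<Rightarrow> 'x) \<times> ('a \<Rightarrow> 'c) \<Rightarrow> bool" where
  "bound_morphism _ Q \<rho> T F \<longleftrightarrow>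
     quiver_morphism T Q F \<and>
     \<not> (\<exists>(n, p)\<in>quiver_paths T.
          (basis_vec (fst F n, map (snd F) p) :: ('x, 'c, 'k) path_alg) \<in> relation_ideal Q \<rho>)"

definition rooted_tree_over :: "'k::field itself \<Rightarrow> ('x, 'c) pre_digraph \<Rightarrow> ('x, 'c) path set \<Rightarrow>
    ('v, 'a) pre_digraph \<Rightarrow> ('v \<Rightarrow> 'x) \<times> ('a \<Rightarrow> 'c) \<Rightarrow> bool" where
  "rooted_tree_over K Q \<rho> T F \<longleftrightarrow> rooted_tree T \<and> bound_morphism K Q \<rho> T F"


section \<open>Rooted tree modules\<close>

text \<open>
  The vector space with basis \<open>T\<^sub>0\<close> consists of the coordinate functions vanishing outside
  \<open>T\<^sub>0\<close>; the basis vector of \<open>n\<close> is \<^term>\<open>basis_vec n\<close>.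
\<close>

definition vertex_space :: "('v, 'a) pre_digraph \<Rightarrow> ('v \<Rightarrow> 'k::field) set" where
  "vertex_space T = {v. \<forall>n. n \<notin> verts T \<longrightarrow> v n = 0}"

definition linear_ext ::
    "('v, 'a) pre_digraph \<Rightarrow> ('v \<Rightarrow> 'w \<Rightarrow> 'k::field) \<Rightarrow> ('v \<Rightarrow> 'k) \<Rightarrow> 'w \<Rightarrow> 'k" where
  "linear_ext T g v = (\<Sum>n\<in>verts T. scale (v n) (g n))"

definition vertex_act :: "('v, 'a) pre_digraph \<Rightarrow> ('v \<Rightarrow> 'x) \<times> ('a \<Rightarrow> 'c) \<Rightarrow>
    'x \<Rightarrow> ('v \<Rightarrow> 'k::field) \<Rightarrow> 'v \<Rightarrow> 'k" where
  "vertex_act T F x = linear_ext T (\<lambda>n. if fst F n = x then basis_vec n else 0)"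

definition arrow_act :: "('v, 'a) pre_digraph \<Rightarrow> ('v \<Rightarrow> 'x) \<times> ('a \<Rightarrow> 'c) \<Rightarrow>
    'c \<Rightarrow> ('v \<Rightarrow> 'k::field) \<Rightarrow> 'v \<Rightarrow> 'k" where
  "arrow_act T F \<gamma> =
     linear_ext T (\<lambda>n. \<Sum>a | a \<in> arcs T \<and> tail T a = n \<and> snd F a = \<gamma>. basis_vec (head T a))"

definition path_act :: "('v, 'a) pre_digraph \<Rightarrow> ('v \<Rightarrow> 'x) \<times> ('a \<Rightarrow> 'c) \<Rightarrow>
    ('x, 'c) path \<Rightarrow> ('v \<Rightarrow> 'k::field) \<Rightarrow> 'v \<Rightarrow> 'k" where
  "path_act T F p v = fold (arrow_act T F) (snd p) (vertex_act T F (fst p) v)"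

definition path_algebra_act :: "('v, 'a) pre_digraph \<Rightarrow> ('v \<Rightarrow> 'x) \<times> ('a \<Rightarrow> 'c) \<Rightarrow>
    ('x, 'c, 'k::field) path_alg \<Rightarrow> ('v \<Rightarrow> 'k) \<Rightarrow> 'v \<Rightarrow> 'k" where
  "path_algebra_act T F f v = (\<Sum>p | f p \<noteq> 0. scale (f p) (path_act T F p v))"

record ('r, 'm) left_module =
  elts :: "'m set"
  lact :: "'r \<Rightarrow> 'm \<Rightarrow> 'm"

text \<open>
  A coset acts as any of its representatives; \<open>tree_module_act\<close> below shows that the choice does
  not matter.
\<close>

definition tree_module :: "('v, 'a) pre_digraph \<Rightarrow> ('v \<Rightarrow> 'x) \<times> ('a \<Rightarrow> 'c) \<Rightarrow>
    (('x, 'c, 'k::field) path_alg set, 'v \<Rightarrow> 'k) left_module" where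
  "tree_module T F =
     \<lparr> elts = vertex_space T,
       lact = (\<lambda>A v. the_elem ((\<lambda>f. path_algebra_act T F f v) ` A)) \<rparr>"

text \<open>
  As functions in HOL are total, homomorphisms are normalised to vanish outside of their domain.
\<close>

definition module_homs :: "'r set \<Rightarrow> ('r, 'v \<Rightarrow> 'k::field) left_module \<Rightarrow>
    ('r, 'w \<Rightarrow> 'k) left_module \<Rightarrow> (('v \<Rightarrow> 'k) \<Rightarrow> ('w \<Rightarrow> 'k)) set" where
  "module_homs R M N = {f.
     (\<forall>u\<in>elts M. f u \<in> elts N) \<and>
     (\<forall>u\<in>elts M. \<forall>v\<in>elts M. f (u + v) = f u + f v) \<and>
     (\<forall>c. \<forall>u\<in>elts M. f (scale c u) = scale c (f u)) \<and>
     (\<forall>r\<in>R. \<forall>u\<in>elts M. f (lact M r u) = lact N r (f u)) \<and>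
     (\<forall>u. u \<notin> elts M \<longrightarrow> f u = 0)}"


section \<open>Networks\<close>

record ('v, 'a) network = "('v, 'a) pre_digraph" +
  edges :: "'v set set"

definition subnetwork :: "('v, 'a) network \<Rightarrow> ('v, 'a) network \<Rightarrow> bool" where
  "subnetwork M N \<longleftrightarrow>
     verts M \<subseteq> verts N \<and> arcs M \<subseteq> arcs N \<and> edges M \<subseteq> edges N \<and>
     tail M = tail N \<and> head M = head N \<and>
     (\<forall>a\<in>arcs M. tail M a \<in> verts M \<and> head M a \<in> verts M) \<and>
     (\<forall>e\<in>edges M. e \<subseteq> verts M)"

datatype ('v, 'a) link = Arrow 'a | Arrow_Inv 'a | Edge "'v set"

fun link_inv :: "('v, 'a) link \<Rightarrow> ('v, 'a) link" where
  "link_inv (Arrow a) = Arrow_Inv a"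
| "link_inv (Arrow_Inv a) = Arrow a"
| "link_inv (Edge e) = Edge e"

fun link_from_to :: "('v, 'a) network \<Rightarrow> 'v \<Rightarrow> ('v, 'a) link \<Rightarrow> 'v \<Rightarrow> bool" where
  "link_from_to N u (Arrow a) v \<longleftrightarrow> a \<in> arcs N \<and> tail N a = u \<and> head N a = v"
| "link_from_to N u (Arrow_Inv a) v \<longleftrightarrow> a \<in> arcs N \<and> head N a = u \<and> tail N a = v"
| "link_from_to N u (Edge e) v \<longleftrightarrow> e \<in> edges N \<and> e = {u, v}"

fun network_walk :: "('v, 'a) network \<Rightarrow> 'v \<Rightarrow> ('v, 'a) link list \<Rightarrow> 'v \<Rightarrow> bool" where
  "network_walk N u [] v \<longleftrightarrow> u \<in> verts N \<and> u = v"
| "network_walk N u (l # ls) v \<longleftrightarrow> (\<exists>w. link_from_to N u l w \<and> network_walk N w ls v)"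

definition traversal :: "('v, 'a) network \<Rightarrow> 'v \<Rightarrow> ('v, 'a) link list \<Rightarrow> 'v \<Rightarrow> bool" where
  "traversal N u ls v \<longleftrightarrow>
     network_walk N u ls v \<and> (\<forall>i. Suc i < length ls \<longrightarrow> ls ! Suc i \<noteq> link_inv (ls ! i))"

definition triangle :: "('v, 'a) network \<Rightarrow> 'v set \<Rightarrow> bool" where
  "triangle N S \<longleftrightarrow>
     S \<subseteq> verts N \<and> card S = 3 \<and>
     card {a \<in> arcs N. tail N a \<in> S \<and> head N a \<in> S} + card {e \<in> edges N. e \<subseteq> S} = 3"

text \<open>A traversal, as an object, is the pair of its starting vertex and its list of links.\<close>

definition triangle_traversals :: "('v, 'a) network \<Rightarrow> ('v \<times> ('v, 'a) link list) set" where
  "triangle_traversals N = {(u, [l, l']) | u l l'. \<exists>w v.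
     link_from_to N u l w \<and> link_from_to N w l' v \<and>
     traversal N u [l, l'] v \<and> triangle N {u, w, v}}"


section \<open>The pullback network and its 2-covering\<close>

text \<open>
  In a rooted tree the parent of \<open>n\<close> is the head of the unique arrow with source \<open>n\<close>,
  so arrows and their sources determine the remaining data.
\<close>

definition pullback_network :: "('v, 'a) pre_digraph \<Rightarrow> ('v \<Rightarrow> 'x) \<times> ('a \<Rightarrow> 'c) \<Rightarrow>
    ('w, 'b) pre_digraph \<Rightarrow> ('w \<Rightarrow> 'x) \<times> ('b \<Rightarrow> 'c) \<Rightarrow> ('v \<times> 'w, 'a \<times> 'b) network" where
  "pullback_network T1 F1 T2 F2 =
    \<lparr> verts = {(n, m). n \<in> verts T1 \<and> m \<in> verts T2 \<and> fst F1 n = fst F2 m},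
      arcs = {(a, b). a \<in> arcs T1 \<and> b \<in> arcs T2 \<and> snd F1 a = snd F2 b},
      tail = (\<lambda>(a, b). (tail T1 a, tail T2 b)),
      head = (\<lambda>(a, b). (head T1 a, head T2 b)),
      edges = {{(n, m), (n, m')} | n m m'.
         n \<in> verts T1 \<and> m \<in> verts T2 \<and> m' \<in> verts T2 \<and>
         fst F1 n = fst F2 m \<and> fst F1 n = fst F2 m' \<and> m \<noteq> m' \<and>
         (\<exists>b\<in>out_arcs T2 m. \<exists>b'\<in>out_arcs T2 m'. head T2 b = head T2 b' \<and> snd F2 b = snd F2 b')} \<rparr>"

definition covering_network :: "('v, 'a) pre_digraph \<Rightarrow> ('v \<Rightarrow> 'x) \<times> ('a \<Rightarrow> 'c) \<Rightarrow>
    ('w, 'b) pre_digraph \<Rightarrow> ('w \<Rightarrow> 'x) \<times> ('b \<Rightarrow> 'c) \<Rightarrow>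
    ('v \<times> 'w \<times> int, 'a \<times> 'b \<times> int) network" where
  "covering_network T1 F1 T2 F2 = (let N = pullback_network T1 F1 T2 F2 in
    \<lparr> verts = {(n, m, j). (n, m) \<in> verts N \<and> j \<in> {-1, 1}},
      arcs = {(a, b, j). (a, b) \<in> arcs N \<and> j \<in> {-1, 1}},
      tail = (\<lambda>(a, b, j). (tail T1 a, tail T2 b, j)),
      head = (\<lambda>(a, b, j). (head T1 a, head T2 b, j)),
      edges = {{(n, m, i), (n, m', -i)} | n m m' i.
         {(n, m), (n, m')} \<in> edges N \<and> i \<in> {-1, 1}} \<rparr>)"

definition forget_sign :: "'p \<times> 'q \<times> int \<Rightarrow> 'p \<times> 'q" where
  "forget_sign = (\<lambda>(n, m, j). (n, m))"

fun link_proj ::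
    "('v \<times> 'w \<times> int, 'a \<times> 'b \<times> int) link \<Rightarrow> ('v \<times> 'w, 'a \<times> 'b) link" where
  "link_proj (Arrow a) = Arrow (forget_sign a)"
| "link_proj (Arrow_Inv a) = Arrow_Inv (forget_sign a)"
| "link_proj (Edge e) = Edge (forget_sign ` e)"

definition covering_triangle_traversals :: "('v, 'a) pre_digraph \<Rightarrow> ('v \<Rightarrow> 'x) \<times> ('a \<Rightarrow> 'c) \<Rightarrow>
    ('w, 'b) pre_digraph \<Rightarrow> ('w \<Rightarrow> 'x) \<times> ('b \<Rightarrow> 'c) \<Rightarrow>
    (('v \<times> 'w \<times> int) \<times> ('v \<times> 'w \<times> int, 'a \<times> 'b \<times> int) link list) set" where
  "covering_triangle_traversals T1 F1 T2 F2 = {(u, ls).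
     (\<exists>v. traversal (covering_network T1 F1 T2 F2) u ls v) \<and>
     (forget_sign u, map link_proj ls) \<in> triangle_traversals (pullback_network T1 F1 T2 F2)}"


section \<open>Generalized graph maps\<close>

definition triangle_free :: "('v, 'a) pre_digraph \<Rightarrow> ('v \<Rightarrow> 'x) \<times> ('a \<Rightarrow> 'c) \<Rightarrow>
    ('w, 'b) pre_digraph \<Rightarrow> ('w \<Rightarrow> 'x) \<times> ('b \<Rightarrow> 'c) \<Rightarrow>
    ('v \<times> 'w \<times> int, 'a \<times> 'b \<times> int) network \<Rightarrow> bool" where
  "triangle_free T1 F1 T2 F2 M \<longleftrightarrow>
     (\<forall>u ls v. traversal M u ls v \<longrightarrow> (u, ls) \<notin> covering_triangle_traversals T1 F1 T2 F2)"

definition involution_free :: "('v \<times> 'w \<times> int, 'a \<times> 'b \<times> int) network \<Rightarrow> bool" where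
  "involution_free M \<longleftrightarrow> (\<forall>n m j. (n, m, j) \<in> verts M \<longrightarrow> (n, m, -j) \<notin> verts M)"

definition network_connected :: "('v, 'a) network \<Rightarrow> bool" where
  "network_connected M \<longleftrightarrow> (\<forall>u\<in>verts M. \<forall>v\<in>verts M. \<exists>ls. traversal M u ls v)"

definition network_complete :: "('v, 'a) pre_digraph \<Rightarrow> ('v \<Rightarrow> 'x) \<times> ('a \<Rightarrow> 'c) \<Rightarrow>
    ('w, 'b) pre_digraph \<Rightarrow> ('w \<Rightarrow> 'x) \<times> ('b \<Rightarrow> 'c) \<Rightarrow>
    ('v \<times> 'w \<times> int, 'a \<times> 'b \<times> int) network \<Rightarrow> bool" where
  "network_complete T1 F1 T2 F2 M \<longleftrightarrow> (\<forall>n m j. (n, m, j) \<in> verts M \<longrightarrow>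
     (\<forall>a\<in>in_arcs T1 n. \<exists>b\<in>in_arcs T2 m. (a, b, j) \<in> arcs M) \<and>
     (\<forall>b\<in>out_arcs T2 m.
        (\<exists>a\<in>out_arcs T1 n. (a, b, j) \<in> arcs M) \<or>
        (\<exists>b''\<in>in_arcs T2 (head T2 b). snd F2 b = snd F2 b'' \<and>
           (n, tail T2 b'', -j) \<in> verts M \<and>
           {(n, m, j), (n, tail T2 b'', -j)} \<in> edges M)))"

definition generalized_graph_map :: "('v, 'a) pre_digraph \<Rightarrow> ('v \<Rightarrow> 'x) \<times> ('a \<Rightarrow> 'c) \<Rightarrow>
    ('w, 'b) pre_digraph \<Rightarrow> ('w \<Rightarrow> 'x) \<times> ('b \<Rightarrow> 'c) \<Rightarrow>
    ('v \<times> 'w \<times> int, 'a \<times> 'b \<times> int) network \<Rightarrow> bool" where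
  "generalized_graph_map T1 F1 T2 F2 M \<longleftrightarrow>
     subnetwork M (covering_network T1 F1 T2 F2) \<and> verts M \<noteq> {} \<and>
     network_complete T1 F1 T2 F2 M \<and> network_connected M \<and>
     triangle_free T1 F1 T2 F2 M \<and> involution_free M"

text \<open>Extended by zero outside of the vector space, as in \<^const>\<open>module_homs\<close>.\<close>

definition network_map :: "('v, 'a) pre_digraph \<Rightarrow>
    ('v \<times> 'w \<times> int, 'a \<times> 'b \<times> int) network \<Rightarrow> ('v \<Rightarrow> 'k::field) \<Rightarrow> 'w \<Rightarrow> 'k" where
  "network_map T1 M v =
     (if v \<in> vertex_space T1
      then linear_ext T1
        (\<lambda>n. \<Sum>(m, j) | (n, m, j) \<in> verts M. scale (of_int j) (basis_vec m)) v
      else 0)"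


section \<open>The action of the bound quiver algebra is well defined\<close>

lemma sum_fun_apply: "(\<Sum>i\<in>A. w i) x = (\<Sum>i\<in>A. w i x)"
  for w :: "'i \<Rightarrow> 'b \<Rightarrow> 'd::comm_monoid_add"
  by (induction A rule: infinite_finite_induct) auto

lemma scale_fun_sum_right: "scale c (\<Sum>i\<in>A. w i) = (\<Sum>i\<in>A. scale c (w i))"
  for w :: "'i \<Rightarrow> 'b \<Rightarrow> 'd::field"
  by (rule ext) (simp add: scale_def sum_fun_apply sum_distrib_left)

lemma scale_fun_sum_left: "scale (\<Sum>i\<in>A. c i) w = (\<Sum>i\<in>A. scale (c i) w)"
  for w :: "'b \<Rightarrow> 'd::field"
  by (rule ext) (simp add: scale_def sum_fun_apply sum_distrib_right)

lemma linear_ext_apply: "linear_ext T g v m = (\<Sum>n\<in>verts T. v n * g n m)"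
  by (simp add: linear_ext_def scale_def sum_fun_apply)

lemma linear_ext_add: "linear_ext T g (u + v) = linear_ext T g u + linear_ext T g v"
  by (rule ext) (simp add: linear_ext_apply algebra_simps sum.distrib)

lemma linear_ext_scale: "linear_ext T g (scale c v) = scale c (linear_ext T g v)"
  by (rule ext) (simp add: linear_ext_apply scale_def algebra_simps sum_distrib_left)

lemma path_act_add: "path_act T F p (u + v) = path_act T F p u + path_act T F p v"
proof -
  have "fold (arrow_act T F) ps (u + v) = fold (arrow_act T F) ps u + fold (arrow_act T F) ps v"
    for ps u v
    by (induction ps arbitrary: u v) (simp_all add: arrow_act_def linear_ext_add)
  thus ?thesis by (simp add: path_act_def vertex_act_def linear_ext_add)
qed

lemma path_act_scale: "path_act T F p (scale c v) = scale c (path_act T F p v)"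
proof -
  have "fold (arrow_act T F) ps (scale c u) = scale c (fold (arrow_act T F) ps u)" for ps u
    by (induction ps arbitrary: u) (simp_all add: arrow_act_def linear_ext_scale)
  thus ?thesis by (simp add: path_act_def vertex_act_def linear_ext_scale)
qed

lemma path_act_zero: "path_act T F p 0 = 0"
  using path_act_scale[of T F p 0 0] by (simp add: scale_def zero_fun_def)

lemma path_act_sum: "path_act T F p (\<Sum>i\<in>A. u i) = (\<Sum>i\<in>A. path_act T F p (u i))"
  by (induction A rule: infinite_finite_induct)
    (simp_all only: sum.infinite sum.empty sum.insert path_act_zero path_act_add not_False_eq_True)

lemma vertex_act_apply:
  assumes "finite (verts T)"
  shows "vertex_act T F x v m = (if m \<in> verts T \<and> fst F m = x then v m else 0)"
proof -
  have "vertex_act T F x v m =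
      (\<Sum>n\<in>verts T. if n = m then (if fst F m = x then v m else 0) else 0)"
    unfolding vertex_act_def linear_ext_apply
    by (rule sum.cong) (auto simp: basis_vec_def)
  thus ?thesis using assms by simp
qed

lemma arrow_act_nonzeroE:
  fixes v :: "'v \<Rightarrow> 'k::field"
  assumes "arrow_act T F \<gamma> v m \<noteq> 0"
  obtains a where "a \<in> arcs T" "snd F a = \<gamma>" "head T a = m" "v (tail T a) \<noteq> 0"
proof -
  from assms obtain n where n: "v n \<noteq> 0"
    "(\<Sum>a | a \<in> arcs T \<and> tail T a = n \<and> snd F a = \<gamma>. basis_vec (head T a)) m \<noteq> (0::'k)"
    unfolding arrow_act_def linear_ext_apply by (force elim: sum.not_neutral_contains_not_neutral)
  from n(2) obtain a where "a \<in> arcs T" "tail T a = n" "snd F a = \<gamma>" "basis_vec (head T a) m \<noteq> (0::'k)"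
    unfolding sum_fun_apply by (force elim: sum.not_neutral_contains_not_neutral)
  with n(1) that show thesis by (auto simp: basis_vec_def split: if_splits)
qed

lemma fold_arrow_nonzeroE:
  assumes T: "wf_digraph T" and "fold (arrow_act T F) ps u m \<noteq> 0"
    and "\<And>n. u n \<noteq> 0 \<Longrightarrow> n \<in> verts T"
  obtains n as where "pre_digraph.awalk T n as m" "map (snd F) as = ps" "u n \<noteq> 0"
  using assms(2,3)
proof (induction ps arbitrary: u thesis)
  case Nil
  thus ?case using Nil(1)[of m "[]"] by (simp add: pre_digraph.awalk_def pre_digraph.cas.simps)
next
  case (Cons g ps)
  interpret wf_digraph T by (rule T)
  have "n \<in> verts T" if "arrow_act T F g u n \<noteq> 0" for n
    using that by (auto elim: arrow_act_nonzeroE)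
  then obtain n as where 1: "awalk n as m" "map (snd F) as = ps" "arrow_act T F g u n \<noteq> 0"
    using Cons.IH[of "arrow_act T F g u"] Cons.prems(2) by auto
  from 1(3) obtain a where "a \<in> arcs T" "snd F a = g" "head T a = n" "u (tail T a) \<noteq> 0"
    by (rule arrow_act_nonzeroE)
  with 1 show ?case using Cons.prems(1)[of "tail T a" "a # as"] by (auto simp: awalk_Cons_iff)
qed

lemma path_act_nonzeroE:
  assumes "fin_digraph T" and "path_act T F (x, ps) v m \<noteq> 0"
  obtains n as where "pre_digraph.awalk T n as m" "map (snd F) as = ps" "fst F n = x" "v n \<noteq> 0"
proof -
  interpret fin_digraph T by (rule assms)
  have "n \<in> verts T \<and> fst F n = x \<and> v n \<noteq> 0" if "vertex_act T F x v n \<noteq> 0" for n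
    using that by (auto simp: vertex_act_apply split: if_splits)
  with assms(2) that show thesis
    unfolding path_act_def by (auto elim!: fold_arrow_nonzeroE[OF wf_digraph])
qed

lemma path_act_in_space:
  assumes "fin_digraph T" shows "path_act T F p v \<in> vertex_space T"
proof -
  interpret fin_digraph T by (rule assms)
  have "n \<in> verts T" if "path_act T F (fst p, snd p) v n \<noteq> 0" for n
    using that by (rule path_act_nonzeroE[OF assms]) auto
  thus ?thesis by (auto simp: vertex_space_def)
qed

lemma quiver_morphism_awalk:
  assumes "quiver_morphism T Q F" and "pre_digraph.awalk T n as m"
  shows "pre_digraph.awalk Q (fst F n) (map (snd F) as) (fst F m)"
  using assms(2)
proof (induction as arbitrary: n)
  case Nil
  thus ?case using assms(1)
    by (auto simp: pre_digraph.awalk_def pre_digraph.cas.simps quiver_morphism_def)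
next
  case (Cons a as)
  have a: "a \<in> arcs T" "tail T a = n" "pre_digraph.cas T (head T a) as m" "set as \<subseteq> arcs T" "n \<in> verts T"
    using Cons.prems by (auto simp: pre_digraph.awalk_def pre_digraph.cas.simps)
  have "pre_digraph.cas Q (fst F n) (map (snd F) as) (fst F m)"
    if "pre_digraph.cas T n as m" "set as \<subseteq> arcs T" for n as
    using that
    by (induction as arbitrary: n)
      (use assms(1) in \<open>auto simp: pre_digraph.cas.simps quiver_morphism_def\<close>)
  from this[OF a(3,4)] show ?case using assms(1) a
    by (auto simp: pre_digraph.awalk_def pre_digraph.cas.simps quiver_morphism_def)
qed

lemma cas_awlast: "pre_digraph.cas Q x p y \<Longrightarrow> pre_digraph.awlast Q x p = y"
proof (induction p arbitrary: x)
  case (Cons a p)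
  have "pre_digraph.awalk_verts Q (head Q a) p \<noteq> []"
    by (cases p) (simp_all add: pre_digraph.awalk_verts.simps)
  with Cons show ?case by (simp add: pre_digraph.cas.simps pre_digraph.awalk_verts.simps)
qed (simp add: pre_digraph.cas.simps pre_digraph.awalk_verts.simps)

lemma path_act_comp:
  fixes v :: "'v \<Rightarrow> 'k::field"
  assumes T: "fin_digraph T" and F: "quiver_morphism T Q F"
  shows "path_act T F (y, ps) (path_act T F (x, qs) v) =
    (if y = pre_digraph.awlast Q x qs then path_act T F (x, qs @ ps) v else 0)"
proof -
  interpret fin_digraph T by (rule T)
  define u where "u = path_act T F (x, qs) v"
  have u: "m \<in> verts T \<and> fst F m = pre_digraph.awlast Q x qs" if um: "u m \<noteq> 0" for m
  proof -
    obtain n as where n: "awalk n as m" "map (snd F) as = qs" "fst F n = x"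
      using um path_act_nonzeroE[OF T] unfolding u_def by metis
    show ?thesis using quiver_morphism_awalk[OF F n(1)] n
      by (auto simp: pre_digraph.awalk_def[of Q] dest: cas_awlast)
  qed
  have v: "vertex_act T F y u = (if y = pre_digraph.awlast Q x qs then u else 0)"
    by (rule ext) (use u in \<open>auto simp: vertex_act_apply\<close>)
  have z: "fold (arrow_act T F) ps 0 = (0 :: 'v \<Rightarrow> 'k)" for ps
  proof (induction ps)
    case (Cons c ps)
    have "arrow_act T F c 0 = (0 :: 'v \<Rightarrow> 'k)"
      by (rule ext) (simp add: arrow_act_def linear_ext_apply)
    with Cons show ?case by (simp only: fold_simps)
  qed (simp only: fold_simps)
  show ?thesis
    unfolding u_def[symmetric] by (simp add: path_act_def v z) (simp add: u_def path_act_def)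
qed

lemma path_algebra_act_superset:
  assumes "finite A" "{p. f p \<noteq> 0} \<subseteq> A"
  shows "path_algebra_act T F f v = (\<Sum>p\<in>A. scale (f p) (path_act T F p v))"
  unfolding path_algebra_act_def using assms
  by (intro sum.mono_neutral_left) (auto simp: scale_def zero_fun_def)

lemma path_algebra_act_add:
  assumes "f \<in> path_algebra Q" "g \<in> path_algebra Q"
  shows "path_algebra_act T F (f + g) v = path_algebra_act T F f v + path_algebra_act T F g v"
proof -
  let ?A = "{p. f p \<noteq> 0} \<union> {p. g p \<noteq> 0}"
  have fin: "finite ?A" using assms by (auto simp: path_algebra_def)
  have *: "scale (f p + g p) w = scale (f p) w + scale (g p) w" for p w
    by (rule ext) (simp add: scale_def algebra_simps)
  have "path_algebra_act T F (f + g) v = (\<Sum>p\<in>?A. scale ((f + g) p) (path_act T F p v))"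
    by (rule path_algebra_act_superset) (use fin in auto)
  also have "\<dots> = (\<Sum>p\<in>?A. scale (f p) (path_act T F p v)) + (\<Sum>p\<in>?A. scale (g p) (path_act T F p v))"
    by (simp add: * sum.distrib)
  also have "\<dots> = path_algebra_act T F f v + path_algebra_act T F g v"
    using fin by (simp add: path_algebra_act_superset[of ?A, symmetric])
  finally show ?thesis .
qed

lemma path_algebra_supp:
  assumes "f \<in> path_algebra Q" "g \<in> path_algebra Q"
    and "{p. h p \<noteq> 0} \<subseteq> {p. f p \<noteq> 0} \<union> {p. g p \<noteq> 0}"
  shows "h \<in> path_algebra Q"
proof -
  have "finite ({p. f p \<noteq> 0} \<union> {p. g p \<noteq> 0})"
    using assms by (auto simp: path_algebra_def)
  from finite_subset[OF assms(3) this] show ?thesis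
    using assms by (fastforce simp: path_algebra_def)
qed

lemma path_algebra_act_scale:
  assumes "f \<in> path_algebra Q"
  shows "path_algebra_act T F (scale c f) v = scale c (path_algebra_act T F f v)"
proof -
  have fin: "finite {p. f p \<noteq> 0}" using assms by (auto simp: path_algebra_def)
  have "path_algebra_act T F (scale c f) v
      = (\<Sum>p | f p \<noteq> 0. scale (scale c f p) (path_act T F p v))"
    by (rule path_algebra_act_superset) (use fin in \<open>auto simp: scale_def\<close>)
  thus ?thesis by (simp add: path_algebra_act_def scale_fun_sum_right) (simp add: scale_def algebra_simps)
qed

lemma path_algebra_act_in_space:
  assumes "fin_digraph T" shows "path_algebra_act T F f v \<in> vertex_space T"
proof -
  have "(\<Sum>p\<in>A. scale (f p) (path_act T F p v)) n = 0" if "n \<notin> verts T" for A n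
    using path_act_in_space[OF assms, of F _ v] that
    by (auto simp: vertex_space_def scale_def sum_fun_apply)
  thus ?thesis by (simp add: path_algebra_act_def vertex_space_def)
qed

lemma path_mult_nonzeroE:
  assumes "path_mult Q f g r \<noteq> 0"
  obtains x qs ps where "r = (x, qs @ ps)" "f (pre_digraph.awlast Q x qs, ps) \<noteq> 0" "g (x, qs) \<noteq> 0"
proof -
  obtain x rs where r: "r = (x, rs)" by (cases r)
  with assms obtain i where
    "f (pre_digraph.awlast Q x (take i rs), drop i rs) * g (x, take i rs) \<noteq> 0"
    unfolding path_mult_def by (auto elim: sum.not_neutral_contains_not_neutral)
  with r that[of x "take i rs" "drop i rs"] show thesis by auto
qed

lemma path_mult_supp:
  "{r. path_mult Q f g r \<noteq> 0} \<subseteq> (\<lambda>(p, q). (fst q, snd q @ snd p)) `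
     {(p, q). f p \<noteq> 0 \<and> g q \<noteq> 0 \<and> fst p = pre_digraph.awlast Q (fst q) (snd q)}"
  by (force elim: path_mult_nonzeroE simp: image_iff)

lemma path_algebra_mult:
  assumes Q: "wf_digraph Q" and fg: "f \<in> path_algebra Q" "g \<in> path_algebra Q"
  shows "path_mult Q f g \<in> path_algebra Q"
proof -
  interpret wf_digraph Q by (rule Q)
  have "{(p, q). f p \<noteq> 0 \<and> g q \<noteq> 0 \<and> fst p = awlast (fst q) (snd q)}
      \<subseteq> {p. f p \<noteq> 0} \<times> {q. g q \<noteq> 0}" by auto
  moreover have "finite ({p. f p \<noteq> 0} \<times> {q. g q \<noteq> 0})"
    using fg by (auto simp: path_algebra_def)
  ultimately have fin: "finite {r. path_mult Q f g r \<noteq> 0}"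
    by (intro finite_subset[OF path_mult_supp] finite_imageI) (rule finite_subset)
  have "r \<in> quiver_paths Q" if r: "path_mult Q f g r \<noteq> 0" for r
  proof -
    from r obtain x qs ps where *: "r = (x, qs @ ps)" "f (awlast x qs, ps) \<noteq> 0" "g (x, qs) \<noteq> 0"
      by (rule path_mult_nonzeroE)
    with fg obtain y z where "awalk x qs y" "awalk (awlast x qs) ps z"
      unfolding path_algebra_def quiver_paths_def by blast
    hence "awalk x (qs @ ps) z" by (auto simp: awalk_append_iff)
    with * show ?thesis by (auto simp: quiver_paths_def)
  qed
  with fin show ?thesis by (auto simp: path_algebra_def)
qed

lemma path_algebra_act_mult:
  fixes f :: "('x, 'c, 'k::field) path_alg"
  assumes T: "fin_digraph T" and F: "quiver_morphism T Q F"
    and fg: "f \<in> path_algebra Q" "g \<in> path_algebra Q"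
  shows "path_algebra_act T F (path_mult Q f g) v =
    path_algebra_act T F f (path_algebra_act T F g v)"
proof -
  let ?P = "{p. f p \<noteq> 0}" and ?S = "{q. g q \<noteq> 0}"
  define D where "D = {(p, q). f p \<noteq> 0 \<and> g q \<noteq> 0 \<and> fst p = pre_digraph.awlast Q (fst q) (snd q)}"
  define comp :: "('x, 'c) path \<times> ('x, 'c) path \<Rightarrow> ('x, 'c) path"
    where "comp = (\<lambda>(p, q). (fst q, snd q @ snd p))"
  have fin: "finite ?P" "finite ?S" using fg by (auto simp: path_algebra_def)
  have D: "D \<subseteq> ?P \<times> ?S" by (auto simp: D_def)
  hence finD: "finite D" using fin by (meson finite_SigmaI finite_subset)
  have coeff: "path_mult Q f g r = (\<Sum>(p, q) | (p, q) \<in> D \<and> comp (p, q) = r. f p * g q)" for r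
  proof -
    obtain x rs where r: "r = (x, rs)" by (cases r)
    let ?h = "\<lambda>i. ((pre_digraph.awlast Q x (take i rs), drop i rs), (x, take i rs))"
    have inj: "inj_on ?h {..length rs}"
      by (auto simp: inj_on_def dest: arg_cong[of _ _ length])
    have "(\<Sum>(p, q) | (p, q) \<in> D \<and> comp (p, q) = r. f p * g q)
        = (\<Sum>(p, q)\<in>?h ` {..length rs}. f p * g q)"
    proof (rule sum.mono_neutral_left)
      show "{(p, q). (p, q) \<in> D \<and> comp (p, q) = r} \<subseteq> ?h ` {..length rs}"
      proof
        fix z assume "z \<in> {(p, q). (p, q) \<in> D \<and> comp (p, q) = r}"
        hence "z = ?h (length (snd (snd z)))" "length (snd (snd z)) \<le> length rs"
          by (auto simp: D_def comp_def r prod_eq_iff)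
        thus "z \<in> ?h ` {..length rs}" by blast
      qed
    qed (auto simp: D_def comp_def r)
    also have "\<dots> = path_mult Q f g r"
      by (simp add: r path_mult_def sum.reindex[OF inj])
    finally show ?thesis by simp
  qed
  have "path_algebra_act T F (path_mult Q f g) v
      = (\<Sum>r\<in>comp ` D. scale (path_mult Q f g r) (path_act T F r v))"
    by (rule path_algebra_act_superset) (use finD path_mult_supp[of Q f g] in \<open>auto simp: D_def comp_def\<close>)
  also have "\<dots> = (\<Sum>r\<in>comp ` D. \<Sum>z | z \<in> D \<and> comp z = r.
      scale (f (fst z) * g (snd z)) (path_act T F (comp z) v))"
    by (rule sum.cong) (auto simp: coeff scale_fun_sum_left case_prod_unfold intro!: sum.cong)
  also have "\<dots> = (\<Sum>z\<in>D. scale (f (fst z) * g (snd z)) (path_act T F (comp z) v))"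
    by (rule sum.image_gen[symmetric]) (rule finD)
  also have "\<dots> = (\<Sum>z\<in>D. scale (f (fst z) * g (snd z))
      (path_act T F (fst z) (path_act T F (snd z) v)))"
    by (rule sum.cong) (auto simp: D_def comp_def path_act_comp[OF T F])
  also have "\<dots> = (\<Sum>z\<in>?P \<times> ?S. scale (f (fst z) * g (snd z))
      (path_act T F (fst z) (path_act T F (snd z) v)))"
    by (rule sum.mono_neutral_left)
      (use fin D in \<open>auto simp: D_def path_act_comp[OF T F] scale_def zero_fun_def\<close>)
  also have "\<dots> = (\<Sum>p\<in>?P. \<Sum>q\<in>?S. scale (f p) (scale (g q) (path_act T F p (path_act T F q v))))"
    by (simp add: sum.cartesian_product case_prod_unfold scale_def algebra_simps)
  also have "\<dots> = path_algebra_act T F f (path_algebra_act T F g v)"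
    by (simp add: path_algebra_act_def path_act_sum path_act_scale scale_fun_sum_right)
  finally show ?thesis .
qed

lemma relation_ideal_annihilates:
  fixes f :: "('x, 'c, 'k::field) path_alg"
  assumes Q: "wf_digraph Q" and \<rho>: "\<rho> \<subseteq> quiver_paths Q"
    and F: "rooted_tree_over TYPE('k) Q \<rho> T F" and f: "f \<in> relation_ideal Q \<rho>"
  shows "path_algebra_act T F f v = 0"
proof -
  have T: "fin_digraph T" and mor: "quiver_morphism T Q F"
    and bound: "\<And>n as. (n, as) \<in> quiver_paths T \<Longrightarrow>
      (basis_vec (fst F n, map (snd F) as) :: ('x, 'c, 'k) path_alg) \<notin> relation_ideal Q \<rho>"
    using F by (auto simp: rooted_tree_over_def rooted_tree_def quiver_tree_def bound_morphism_def)
  define A where "A = {f \<in> path_algebra Q. \<forall>v. path_algebra_act T F f v = (0 :: _ \<Rightarrow> 'k)}"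
  have zero: "path_algebra_act T F h 0 = 0" for h :: "('x, 'c, 'k) path_alg"
    by (rule ext) (simp add: path_algebra_act_def path_act_zero scale_def sum_fun_apply)
  have add: "a + b \<in> path_algebra Q"
    if "a \<in> path_algebra Q" "b \<in> path_algebra Q" for a b :: "('x, 'c, 'k) path_alg"
    by (rule path_algebra_supp[OF that]) auto
  have scl: "scale c a \<in> path_algebra Q"
    if "a \<in> path_algebra Q" for a :: "('x, 'c, 'k) path_alg" and c
    by (rule path_algebra_supp[OF that that]) (auto simp: scale_def)
  have "two_sided_ideal Q A"
    unfolding two_sided_ideal_def
    by (auto simp: A_def path_algebra_act_add path_algebra_act_scale path_algebra_mult[OF Q] add scl
        path_algebra_act_mult[OF T mor] zero)
      (auto simp: path_algebra_def path_algebra_act_def scale_def zero_fun_def)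
  moreover have "basis_vec p \<in> A" if p: "p \<in> \<rho>" for p
  proof -
    have supp: "{q. basis_vec p q \<noteq> (0 :: 'k)} = {p}" by (auto simp: basis_vec_def)
    have "path_act T F p v = 0" for v :: "_ \<Rightarrow> 'k"
    proof (rule ccontr)
      assume "path_act T F p v \<noteq> 0"
      then obtain m where "path_act T F (fst p, snd p) v m \<noteq> 0" by (auto simp: fun_eq_iff)
      then obtain n as where "pre_digraph.awalk T n as m" "map (snd F) as = snd p" "fst F n = fst p"
        by (rule path_act_nonzeroE[OF T])
      with bound[of n as] have "(basis_vec p :: ('x, 'c, 'k) path_alg) \<notin> relation_ideal Q \<rho>"
        by (auto simp: quiver_paths_def)
      with p show False by (auto simp: relation_ideal_def)
    qed
    thus ?thesis using p \<rho> by (auto simp: A_def path_algebra_def path_algebra_act_def supp scale_def zero_fun_def)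
  qed
  ultimately have "relation_ideal Q \<rho> \<subseteq> A" by (auto simp: relation_ideal_def)
  with f show ?thesis by (auto simp: A_def)
qed

lemma relation_ideal_zero: "0 \<in> relation_ideal Q \<rho>"
  by (auto simp: relation_ideal_def two_sided_ideal_def)

lemma tree_module_act:
  fixes f :: "('x, 'c, 'k::field) path_alg"
  assumes "wf_digraph Q" and "\<rho> \<subseteq> quiver_paths Q"
    and "rooted_tree_over TYPE('k) Q \<rho> T F" and f: "f \<in> path_algebra Q"
  shows "lact (tree_module T F) {g \<in> path_algebra Q. f - g \<in> relation_ideal Q \<rho>} v =
    path_algebra_act T F f v"
proof -
  have "path_algebra_act T F g v = path_algebra_act T F f v"
    if g: "g \<in> path_algebra Q" "f - g \<in> relation_ideal Q \<rho>" for g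
  proof -
    have "f - g \<in> path_algebra Q"
      by (rule path_algebra_supp[OF f g(1)]) auto
    hence "path_algebra_act T F ((f - g) + g) v = path_algebra_act T F g v"
      using g by (simp only: path_algebra_act_add relation_ideal_annihilates[OF assms(1-3)]) simp
    thus ?thesis by simp
  qed
  hence "(\<lambda>g. path_algebra_act T F g v) ` {g \<in> path_algebra Q. f - g \<in> relation_ideal Q \<rho>}
      = {path_algebra_act T F f v}"
    using f relation_ideal_zero[of Q \<rho>] by (auto simp: image_iff intro!: exI[of _ f])
  thus ?thesis by (simp add: tree_module_def)
qed

end

theory Submission
  imports Defs
begin

text \<open>
  Let \<open>c (n, m)\<close> be the matrix coefficients of a homomorphism.  Commuting with the arrow \<open>\<gamma>\<close> says that,
  for all \<open>n\<close>, \<open>h\<close> and \<open>\<gamma>\<close>, the sum of \<open>c (n, m)\<close> over the children \<open>m\<close> of \<open>h\<close> via an arrow over \<open>\<gamma>\<close> is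
  \<open>c (p, h)\<close> if \<open>n\<close> has the parent \<open>p\<close> via an arrow over \<open>\<gamma>\<close>, and \<open>0\<close> otherwise.  The vertices involved in
  one of these equations form a clique of the pullback network, all links and triangles lie in such
  cliques, and the incidence graph of vertices and cliques is a forest.

  A generalized graph map restricts to a perfect matching on the vertices that it has in a clique, and
  matched vertices contribute to the equation with opposite signs; so its coefficients solve the system.
  Conversely, the solutions are spanned by those of minimal support.  If such a solution had three
  nonzero coefficients in a clique, then cutting the forest at two of these vertices and rescaling the
  pieces would give a solution of smaller support.  Hence its support meets each clique in at most two
  vertices, its values agree up to sign, and its support is connected: up to a scalar it comes from
  a generalized graph map.
\<close>

section \<open>Unique parents in rooted trees\<close>

lemma undirected_simps [simp]:
  "verts (undirected T) = verts T" "arcs (undirected T) = arcs T \<times> UNIV"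
  "tail (undirected T) (a, d) = (if d then tail T a else head T a)"
  "head (undirected T) (a, d) = (if d then head T a else tail T a)"
  by (auto simp: undirected_def)

lemma cas_appendI:
  "pre_digraph.cas G u p w \<Longrightarrow> pre_digraph.cas G w q v \<Longrightarrow> pre_digraph.cas G u (p @ q) v"
  by (induction p arbitrary: u) (auto simp: pre_digraph.cas.simps)

lemma cas_undirected_forward:
  "pre_digraph.cas (undirected T) u (map (\<lambda>a. (a, True)) p) v \<longleftrightarrow> pre_digraph.cas T u p v"
  by (induction p arbitrary: u) (auto simp: pre_digraph.cas.simps)

lemma cas_undirected_backward:
  "pre_digraph.cas T u p v \<Longrightarrow> pre_digraph.cas (undirected T) v (rev (map (\<lambda>a. (a, False)) p)) u"
  by (induction p arbitrary: u)
    (auto simp: pre_digraph.cas.simps simp del: pre_digraph.cas_append_iff intro!: cas_appendI)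

lemma (in pre_digraph) cas_heads: "cas u p v \<Longrightarrow> u # map (head G) p = map (tail G) p @ [v]"
  by (induction p arbitrary: u) auto

text \<open>A nonempty closed directed walk contains a directed cycle. Read with all arrows
  travelled forward, it is a cycle of the undirected graph that uses no arrow twice.\<close>

lemma quiver_tree_no_directed_cycle:
  assumes "quiver_tree T" and "pre_digraph.awalk T u p u"
  shows "p = []"
proof (rule ccontr)
  assume "p \<noteq> []"
  interpret fin_digraph T using assms by (simp add: quiver_tree_def)
  interpret U: pre_digraph "undirected T" .
  have "closed_w p" using assms \<open>p \<noteq> []\<close> by (auto simp: closed_w_def)
  then obtain c where "cycle c" using closed_w_imp_cycle by blast
  then obtain v where v: "awalk v c v" "distinct (tl (awalk_verts v c))" "distinct c" "c \<noteq> []"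
    unfolding cycle_conv by blast
  define c' where "c' = map (\<lambda>a. (a, True)) c"
  have cas: "cas v c v" using v by (simp add: awalk_def)
  hence cas': "U.cas v c' v" by (simp add: c'_def cas_undirected_forward)
  have "distinct (map (head T) c)" using v awalk_verts_conv'[OF cas] by simp
  hence "distinct (tl (U.awalk_verts v c'))"
    using U.awalk_verts_conv'[OF cas'] by (simp add: c'_def comp_def)
  moreover have "U.awalk v c' v" using v cas' by (auto simp: U.awalk_def awalk_def c'_def)
  ultimately have "U.cycle c'" using v by (auto simp: U.cycle_def c'_def)
  moreover have "distinct (map fst c')" using v by (simp add: c'_def comp_def)
  ultimately show False using assms(1) by (auto simp: quiver_tree_def)
qed

text \<open>The rank of \<open>u\<close> is the number of vertices that directed walks from
  \<open>u\<close> reach. It drops along an arrow, because the tail cannot be reached again from the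
  head.\<close>

lemma quiver_tree_rank:
  assumes "quiver_tree T"
  obtains rank :: "'v \<Rightarrow> nat" where "\<And>a. a \<in> arcs T \<Longrightarrow> rank (head T a) < rank (tail T a)"
proof
  interpret fin_digraph T using assms by (simp add: quiver_tree_def)
  fix a assume a: "a \<in> arcs T"
  let ?D = "\<lambda>u. {v. \<exists>p. awalk u p v}"
  have "?D (head T a) \<subseteq> ?D (tail T a)"
    using a by (auto simp: awalk_Cons_iff intro: exI[of _ "a # _"])
  moreover have "tail T a \<in> ?D (tail T a)"
    using a by (auto intro!: exI[of _ "[]"] simp: awalk_def)
  moreover have "tail T a \<notin> ?D (head T a)"
  proof
    assume "tail T a \<in> ?D (head T a)"
    then obtain p where "awalk (head T a) p (tail T a)" by blast
    hence "awalk (tail T a) (a # p) (tail T a)" using a by (simp add: awalk_Cons_iff)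
    from quiver_tree_no_directed_cycle[OF assms this] show False by simp
  qed
  moreover have "finite (?D (tail T a))"
    by (rule finite_subset[OF _ finite_verts]) auto
  ultimately show "card (?D (head T a)) < card (?D (tail T a))"
    by (intro psubset_card_mono) auto
qed

text \<open>Two arrows leaving the same vertex would close up to an undirected cycle at the first common
  vertex of the directed walks to the root that they start.\<close>

lemma rooted_tree_out_arc_unique:
  assumes T: "rooted_tree T" and "a \<in> arcs T" "a' \<in> arcs T" "tail T a = tail T a'"
  shows "a = a'"
proof (rule ccontr)
  assume ne: "a \<noteq> a'"
  have qt: "quiver_tree T" using T by (simp add: rooted_tree_def)
  interpret fin_digraph T using qt by (simp add: quiver_tree_def)
  interpret U: pre_digraph "undirected T" .
  obtain rank :: "_ \<Rightarrow> nat" where rank: "\<And>e. e \<in> arcs T \<Longrightarrow> rank (head T e) < rank (tail T e)"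
    using quiver_tree_rank[OF qt] by metis
  obtain r where r: "\<And>u. u \<in> verts T \<Longrightarrow> out_arcs T u = {} \<Longrightarrow> u = r"
    using T unfolding rooted_tree_def by blast
  have to_root: "\<exists>p. awalk u p r" if "u \<in> verts T" for u
    using that
  proof (induction "rank u" arbitrary: u rule: less_induct)
    case less
    show ?case
    proof (cases "out_arcs T u = {}")
      case True
      with r less have "u = r" by blast
      thus ?thesis using less by (auto intro!: exI[of _ "[]"] simp: awalk_def)
    next
      case False
      then obtain e where "e \<in> out_arcs T u" by blast
      hence e: "e \<in> arcs T" "tail T e = u" by auto
      with less.hyps[of "head T e"] rank[of e] obtain p where "awalk (head T e) p r" by auto
      thus ?thesis using e by (auto intro!: exI[of _ "e # p"] simp: awalk_Cons_iff)
    qed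
  qed
  \<comment> \<open>Ranks fall strictly along a directed walk, so no vertex is visited
    twice.\<close>
  have walk_rank: "distinct (map (tail T) p) \<and> (\<forall>e\<in>set p. rank (tail T e) \<le> rank u \<and> rank v < rank (tail T e))
      \<and> rank v \<le> rank u" if "awalk u p v" for u p v
    using that
  proof (induction p arbitrary: u)
    case (Cons e p)
    hence e: "e \<in> arcs T" "tail T e = u" "awalk (head T e) p v" by (auto simp: awalk_Cons_iff)
    from Cons.IH[OF e(3)] rank[OF e(1)] e(2) show ?case by fastforce
  qed (auto simp: awalk_def)
  define n where "n = tail T a"
  \<comment> \<open>\<open>S\<close> collects the vertices reached through \<open>a'\<close>. A
    shortest walk \<open>p\<close> from the head of \<open>a\<close> into \<open>S\<close> meets
    \<open>S\<close> only at its end \<open>v\<close>.\<close>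
  define S where "S = {v. \<exists>q. awalk (head T a') q v}"
  have "\<exists>p v. awalk (head T a) p v \<and> v \<in> S"
    using to_root[of "head T a"] to_root[of "head T a'"] assms by (auto simp: S_def)
  then obtain p where "\<exists>v. awalk (head T a) p v \<and> v \<in> S"
    and p_min: "\<And>p'. \<exists>v. awalk (head T a) p' v \<and> v \<in> S \<Longrightarrow> length p \<le> length p'"
    using ex_has_least_nat[of "\<lambda>p. \<exists>v. awalk (head T a) p v \<and> v \<in> S" _ length] by metis
  then obtain v q where p: "awalk (head T a) p v" and q: "awalk (head T a') q v"
    by (auto simp: S_def)
  have p_S: "tail T e \<notin> S" if e: "e \<in> set p" for e
  proof
    assume "tail T e \<in> S"
    moreover obtain p1 p2 where "p = p1 @ e # p2" using split_list[OF e] by blast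
    moreover from calculation(2) have "awalk (head T a) p1 (tail T e)" "length p1 < length p"
      using p by (auto simp: awalk_append_iff awalk_Cons_iff)
    ultimately show False using p_min[of p1] by fastforce
  qed
  have q_S: "tail T e \<in> S" if e: "e \<in> set q" for e
  proof -
    obtain q1 q2 where "q = q1 @ e # q2" using split_list[OF e] by blast
    thus ?thesis using q by (auto simp: S_def awalk_append_iff awalk_Cons_iff)
  qed
  have n_S: "n \<notin> S"
    using walk_rank rank[of a'] assms by (fastforce simp: S_def n_def)
  have n_p: "tail T e \<noteq> n" if "e \<in> set p" for e
    using walk_rank[OF p] that rank[of a] assms(2) by (fastforce simp: n_def)
  have v_S: "v \<in> S" using q by (auto simp: S_def)
  \<comment> \<open>The cycle runs forward along \<open>a\<close> and \<open>p\<close>, then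
    backward along \<open>q\<close> and \<open>a'\<close>.\<close>
  define c where "c = (a, True) # map (\<lambda>e. (e, True)) p @ rev (map (\<lambda>e. (e, False)) q) @ [(a', False)]"
  have cas: "U.cas n c n"
  proof -
    have "U.cas (head T a) (map (\<lambda>e. (e, True)) p) v"
      using p by (simp add: cas_undirected_forward awalk_def)
    moreover have "U.cas v (rev (map (\<lambda>e. (e, False)) q)) (head T a')"
      using q by (simp only: cas_undirected_backward awalk_def)
    moreover have "U.cas (head T a') [(a', False)] n" using assms by (simp add: n_def)
    ultimately have "U.cas (head T a)
        (map (\<lambda>e. (e, True)) p @ rev (map (\<lambda>e. (e, False)) q) @ [(a', False)]) n"
      by (intro cas_appendI)
    thus ?thesis by (simp add: c_def n_def)
  qed
  have arcs: "set c \<subseteq> arcs T \<times> UNIV" using p q assms by (auto simp: c_def awalk_def)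
  have "n \<in> verts T" using assms by (simp add: n_def)
  with cas arcs have "U.awalk n c n" by (auto simp: U.awalk_def)
  \<comment> \<open>Besides \<open>v\<close>, the vertices are tails of \<open>p\<close>, which
    avoid \<open>S\<close>, tails of \<open>q\<close>, which lie in \<open>S\<close>, and
    \<open>n\<close>, which lies on neither walk.\<close>
  moreover have "distinct (tl (U.awalk_verts n c))"
  proof -
    have pv: "head T a # map (head T) p = map (tail T) p @ [v]"
      using p cas_heads by (auto simp: awalk_def)
    have "tl (U.awalk_verts n c) = map (head (undirected T)) c"
      using U.awalk_verts_conv'[OF cas] by (simp add: c_def)
    also have "\<dots> = (head T a # map (head T) p) @ rev (map (tail T) q) @ [n]"
      using assms(4) by (simp add: c_def comp_def rev_map n_def)
    also have "\<dots> = map (tail T) p @ [v] @ rev (map (tail T) q) @ [n]"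
      unfolding pv by simp
    finally show ?thesis
      using walk_rank[OF p] walk_rank[OF q] p_S q_S n_S n_p v_S by fastforce
  qed
  ultimately have "U.cycle c" by (auto simp: U.cycle_def c_def)
  moreover have "distinct (map fst c)"
  proof -
    have "distinct p" "distinct q" using walk_rank[OF p] walk_rank[OF q] by (auto simp: distinct_map)
    moreover have "set p \<inter> set q = {}" using p_S q_S by blast
    moreover have "a \<notin> set p" "a' \<notin> set p" "a \<notin> set q" "a' \<notin> set q"
      using n_p q_S n_S assms(4) unfolding n_def by metis+
    ultimately show ?thesis using ne by (auto simp: c_def comp_def rev_map)
  qed
  ultimately show False using qt by (auto simp: quiver_tree_def)
qed

section \<open>Linear systems on forests of cliques\<close>

definition supp :: "('p \<Rightarrow> 'k::zero) \<Rightarrow> 'p set" where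
  "supp c = {x. c x \<noteq> 0}"

text \<open>Mapping a vertex \<open>x \<in> L k\<close> to the clique \<open>k\<close>, and \<open>k\<close> to the vertex in \<open>U k\<close> if there is one,
  turns the incidence graph of vertices and cliques into a rooted forest.\<close>

locale clique_forest =
  fixes P :: "'p set" and L U :: "'q \<Rightarrow> 'p set" and rank :: "'p \<Rightarrow> nat"
  assumes finite_P: "finite P"
    and L_P: "L k \<subseteq> P" and U_P: "U k \<subseteq> P"
    and L_unique: "x \<in> L k \<Longrightarrow> x \<in> L k' \<Longrightarrow> k = k'"
    and U_unique: "x \<in> U k \<Longrightarrow> y \<in> U k \<Longrightarrow> x = y"
    and rank_less: "x \<in> L k \<Longrightarrow> y \<in> U k \<Longrightarrow> rank y < rank x"
begin

definition clique :: "'q \<Rightarrow> 'p set" where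
  "clique k = L k \<union> U k"

definition solution :: "('p \<Rightarrow> 'k::field) \<Rightarrow> bool" where
  "solution c \<longleftrightarrow> supp c \<subseteq> P \<and> (\<forall>k. sum c (L k) = sum c (U k))"

text \<open>The nonzero solutions of minimal support; their supports are the circuits of the linear
  matroid given by the solution space.\<close>

definition elementary :: "('p \<Rightarrow> 'k::field) \<Rightarrow> bool" where
  "elementary c \<longleftrightarrow> solution c \<and> c \<noteq> 0 \<and> (\<forall>c'::'p \<Rightarrow> 'k. solution c' \<and> supp c' \<subset> supp c \<longrightarrow> c' = 0)"

lemma finite_L: "finite (L k)" and finite_U: "finite (U k)" and finite_clique: "finite (clique k)"
  using finite_subset[OF L_P finite_P] finite_subset[OF U_P finite_P] by (auto simp: clique_def)

lemma L_U_disjoint: "x \<in> L k \<Longrightarrow> x \<notin> U k"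
  using rank_less[of x k x] by auto

lemma clique_pair:
  assumes "x \<in> clique k" "y \<in> clique k" "x \<noteq> y"
  shows "x \<in> L k \<and> y \<in> L k \<or> x \<in> L k \<and> y \<in> U k \<or> x \<in> U k \<and> y \<in> L k"
  using assms U_unique unfolding clique_def by (metis Un_iff)

lemma finite_supp: "solution c \<Longrightarrow> finite (supp c)"
  using finite_P finite_subset by (auto simp: solution_def)

lemma solution_lin_comb: "solution c \<Longrightarrow> solution c' \<Longrightarrow> solution (\<lambda>x. s * c x + t * c' x)"
proof -
  assume c: "solution c" "solution c'"
  have "supp (\<lambda>x. s * c x + t * c' x) \<subseteq> supp c \<union> supp c'" by (auto simp: supp_def)
  with c show ?thesis
    by (auto simp: solution_def sum.distrib simp flip: sum_distrib_left)
qed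

lemma solution_0: "solution 0"
  by (simp add: solution_def supp_def)

text \<open>Moves the equation of a clique to one side, so that lower and upper vertices enter a
  single sum and differ only in sign.\<close>

lemma clique_eq_0:
  assumes "solution c"
  shows "(\<Sum>x\<in>clique k. if x \<in> L k then c x else - c x) = 0"
proof -
  have "(\<Sum>x\<in>clique k. if x \<in> L k then c x else - c x)
      = (\<Sum>x\<in>L k. c x) + (\<Sum>x\<in>U k. - c x)"
    unfolding clique_def using L_U_disjoint[of _ k]
    by (subst sum.union_disjoint) (auto simp: finite_L finite_U intro!: sum.cong arg_cong2[of _ _ _ _ "(+)"])
  thus ?thesis using assms by (simp add: solution_def sum_negf)
qed

text \<open>A vanishing sum cannot have exactly one nonzero term. This later supplies the links that
  completeness asks for.\<close>

lemma clique_other: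
  assumes "solution c" "x \<in> clique k" "c x \<noteq> 0"
  obtains (other) y where "y \<in> clique k" "y \<noteq> x" "c y \<noteq> 0"
proof (rule ccontr)
  assume no: "\<not> thesis"
  have *: "c y = 0" if "y \<in> clique k - {x}" for y
    using no other that by blast
  have "(\<Sum>y\<in>clique k. if y \<in> L k then c y else - c y) = (\<Sum>y\<in>{x}. if y \<in> L k then c y else - c y)"
    by (rule sum.mono_neutral_right) (use * assms in \<open>auto simp: finite_clique\<close>)
  thus False using clique_eq_0[OF assms(1), of k] assms(3) by (auto split: if_splits)
qed

text \<open>Since \<open>A\<close> contains all or none of the support in each clique, every
  equation is either left unchanged or reduced to 0 = 0.\<close>

lemma solution_restrict:
  assumes c: "solution c"
    and A: "\<And>k x y. x \<in> clique k \<Longrightarrow> y \<in> clique k \<Longrightarrow> c x \<noteq> 0 \<Longrightarrow> c y \<noteq> 0 \<Longrightarrow> x \<in> A \<Longrightarrow> y \<in> A"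
  shows "solution (\<lambda>x. if x \<in> A then c x else 0)" (is "solution ?c")
proof -
  have "sum ?c (L k) = sum ?c (U k)" for k
  proof (cases "\<exists>x\<in>clique k. c x \<noteq> 0 \<and> x \<in> A")
    case True
    with A[of _ k] have "?c y = c y" if "y \<in> clique k" for y using that by force
    hence "sum ?c (L k) = sum c (L k)" "sum ?c (U k) = sum c (U k)"
      by (auto simp: clique_def intro!: sum.cong)
    thus ?thesis using c by (simp add: solution_def)
  next
    case False
    hence "sum ?c (L k) = 0" "sum ?c (U k) = 0" by (auto simp: clique_def intro!: sum.neutral)
    thus ?thesis by simp
  qed
  thus ?thesis using c by (auto simp: solution_def supp_def)
qed

text \<open>By minimality, the restriction to \<open>A\<close> must be all of \<open>c\<close>. This
  serves as an induction principle: what spreads through cliques from one vertex of the support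
  reaches the whole support.\<close>

lemma elementary_supp_subset:
  assumes c: "elementary c" "c x \<noteq> 0" "x \<in> A"
    and A: "\<And>k x y. x \<in> clique k \<Longrightarrow> y \<in> clique k \<Longrightarrow> c x \<noteq> 0 \<Longrightarrow> c y \<noteq> 0 \<Longrightarrow> x \<in> A \<Longrightarrow> y \<in> A"
  shows "supp c \<subseteq> A"
proof -
  let ?c = "\<lambda>x. if x \<in> A then c x else 0"
  have sol: "solution c" using c by (simp add: elementary_def)
  have "solution ?c" by (rule solution_restrict[OF sol]) (rule A)
  moreover have "?c \<noteq> 0" using c by (auto simp: fun_eq_iff)
  ultimately have "\<not> supp ?c \<subset> supp c" using c by (auto simp: elementary_def)
  moreover have "supp ?c = supp c \<inter> A" by (auto simp: supp_def)
  ultimately show ?thesis by blast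
qed

section \<open>Subtrees of the forest\<close>

definition step :: "('p \<times> 'p) set" where
  "step = {(x, y). \<exists>k. x \<in> L k \<and> y \<in> U k}"

text \<open>The subtree with root \<open>x\<close>: \<open>step\<close> leads from a vertex to its
  parent vertex, skipping the clique between them.\<close>

definition below :: "'p \<Rightarrow> 'p set" where
  "below x = {y. (y, x) \<in> step\<^sup>*}"

lemma step_unique: "(x, y) \<in> step \<Longrightarrow> (x, z) \<in> step \<Longrightarrow> y = z"
  unfolding step_def mem_Collect_eq case_prod_conv by (metis L_unique U_unique)

lemma below_rank: "y \<in> below x \<Longrightarrow> y = x \<or> rank x < rank y"
  unfolding below_def mem_Collect_eq
  by (induction rule: converse_rtrancl_induct) (auto simp: step_def dest: rank_less)

text \<open>Steps are deterministic, so the only way from \<open>y\<close> up to \<open>x\<close>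
  starts with \<open>z\<close>.\<close>

lemma below_step: "y \<in> below x \<Longrightarrow> y \<noteq> x \<Longrightarrow> (y, z) \<in> step \<Longrightarrow> z \<in> below x"
  unfolding below_def mem_Collect_eq by (metis converse_rtranclE step_unique)

text \<open>Any step out of \<open>x\<close> leads to the upper vertex of \<open>k\<close>, whose
  rank is already smaller than that of \<open>y\<close>, while everything below \<open>y\<close> has
  at least the rank of \<open>y\<close>.\<close>

lemma below_lower:
  assumes "x \<in> L k" "y \<in> L k" "x \<in> below y"
  shows "x = y"
proof (rule ccontr)
  assume "x \<noteq> y"
  with assms(3) obtain z where z: "(x, z) \<in> step" "z \<in> below y"
    by (auto simp: below_def elim: converse_rtranclE)
  then obtain k' where "x \<in> L k'" "z \<in> U k'" by (auto simp: step_def)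
  hence "z \<in> U k" using assms L_unique by metis
  hence "rank z < rank y" using assms rank_less by blast
  with below_rank[OF z(2)] show False by auto
qed

text \<open>Follow the steps from a common vertex up to \<open>x\<close>. They could leave the
  subtree of \<open>y\<close> only through \<open>y\<close> itself, but \<open>y\<close> is not
  below \<open>x\<close>.\<close>

lemma below_disjoint:
  assumes "x \<in> L k" "y \<in> L k" "x \<noteq> y"
  shows "below x \<inter> below y = {}"
proof -
  have "z \<notin> below y" if "z \<in> below x" for z
    using that unfolding below_def[of x] mem_Collect_eq
  proof (induction rule: converse_rtrancl_induct)
    case base
    show ?case using below_lower assms by blast
  next
    case (step z z')
    have "z \<noteq> y"
    proof
      assume "z = y"
      with step below_lower[of y k x] assms show False
        by (auto simp: below_def intro: converse_rtrancl_into_rtrancl)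
    qed
    with step below_step show ?case by blast
  qed
  thus ?thesis by blast
qed

text \<open>The subtree below \<open>x\<close> is cut off at the clique \<open>k\<close> alone. In
  another clique, an upper vertex of the subtree brings in all lower ones, and a lower vertex
  differs from \<open>x\<close>, so that the step from it stays inside.\<close>

lemma below_clique:
  assumes "x \<in> L k" "k' \<noteq> k" "y \<in> clique k'" "y \<in> below x"
  shows "clique k' \<subseteq> below x"
proof -
  have down: "z \<in> below x" if "u \<in> U k'" "u \<in> below x" "z \<in> L k'" for u z
  proof -
    have "(z, u) \<in> step" using that by (auto simp: step_def)
    thus ?thesis using that by (auto simp: below_def intro: converse_rtrancl_into_rtrancl)
  qed
  show ?thesis
  proof (cases "y \<in> L k'")
    case True
    with assms L_unique have "y \<noteq> x" by blast
    have up: "u \<in> below x" if "u \<in> U k'" for u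
      using below_step[OF assms(4) \<open>y \<noteq> x\<close>] True that by (auto simp: step_def)
    show ?thesis
    proof (cases "U k' = {}")
      case False
      with up down show ?thesis by (auto simp: clique_def)
    next
      case no_U: True
      from assms(4) \<open>y \<noteq> x\<close> obtain z where "(y, z) \<in> step"
        by (auto simp: below_def elim: converse_rtranclE)
      with True no_U L_unique show ?thesis by (auto simp: step_def)
    qed
  next
    case False
    with assms have "y \<in> U k'" by (auto simp: clique_def)
    with assms down U_unique show ?thesis unfolding clique_def by blast
  qed
qed

text \<open>Restricting a solution to the subtree below \<open>x\<close> spoils only the equation of
  \<open>k\<close>, where \<open>x\<close> is the one vertex that survives; the defect is
  \<open>c x\<close>.\<close>

lemma sum_clique_below:
  assumes c: "solution c" and x: "x \<in> L k"
  shows "(\<Sum>z\<in>L k'. if z \<in> below x then c z else 0) - (\<Sum>z\<in>U k'. if z \<in> below x then c z else 0)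
    = (if k' = k then c x else 0)"
proof -
  let ?c = "\<lambda>z. if z \<in> below x then c z else 0"
  consider "k' = k" | "k' \<noteq> k" "clique k' \<inter> below x = {}" | "k' \<noteq> k" "clique k' \<subseteq> below x"
    using below_clique[OF x] by blast
  thus ?thesis
  proof cases
    case 1
    have "sum ?c (L k) = sum ?c {x}"
      using x below_lower[of _ k x] by (intro sum.mono_neutral_right) (auto simp: finite_L)
    moreover have "sum ?c (U k) = 0"
      using rank_less[OF x] below_rank[of _ x] by (intro sum.neutral) fastforce
    ultimately show ?thesis using 1 by (simp add: below_def)
  next
    case 2
    hence "sum ?c (L k') = 0" "sum ?c (U k') = 0" by (auto simp: clique_def intro!: sum.neutral)
    with 2 show ?thesis by simp
  next
    case 3
    hence "sum ?c (L k') = sum c (L k')" "sum ?c (U k') = sum c (U k')"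
      by (auto simp: clique_def intro!: sum.cong)
    with 3 c show ?thesis by (simp add: solution_def)
  qed
qed

text \<open>Cutting the forest below two lower vertices of a clique and rescaling the two pieces yields a
  solution that vanishes at all other vertices of the clique.\<close>

lemma elementary_lower_pair:
  assumes c: "elementary c" and xy: "x \<in> L k" "y \<in> L k" "x \<noteq> y" "c x \<noteq> 0" "c y \<noteq> 0"
    and z: "z \<in> clique k" "c z \<noteq> 0"
  shows "z = x \<or> z = y"
proof (rule ccontr)
  assume "\<not> ?thesis"
  define d where "d w z = (if z \<in> below w then c z else 0)" for w z
  \<comment> \<open>The two pieces violate the equation of \<open>k\<close> by \<open>c x\<close>
    and \<open>c y\<close>; these factors make the defects cancel.\<close>
  define c' where "c' z = c y * d x z - c x * d y z" for z
  have sol: "solution c" using c by (simp add: elementary_def)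
  have "sum c' (L k') - sum c' (U k') = c y * (sum (d x) (L k') - sum (d x) (U k'))
      - c x * (sum (d y) (L k') - sum (d y) (U k'))" for k'
    by (simp add: c'_def sum_subtractf sum_distrib_left[symmetric] algebra_simps)
  hence "sum c' (L k') - sum c' (U k') = 0" for k'
    unfolding d_def using sum_clique_below[OF sol xy(1), of k'] sum_clique_below[OF sol xy(2), of k']
    by simp
  moreover have "supp c' \<subseteq> supp c" by (auto simp: supp_def c'_def d_def)
  ultimately have "solution c'" using sol by (auto simp: solution_def)
  \<comment> \<open>The vertex \<open>z\<close> lies in neither subtree, so it drops out of the
    support.\<close>
  moreover have "c' z = 0"
  proof -
    have "z \<notin> below w" if "w \<in> {x, y}" for w
    proof (cases "z \<in> L k")
      case True
      thus ?thesis using below_lower[of z k w] xy that \<open>\<not> (z = x \<or> z = y)\<close> by auto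
    next
      case False
      hence "z \<in> U k" using z by (simp add: clique_def)
      thus ?thesis using rank_less[of w k z] below_rank[of z w] that xy by auto
    qed
    thus ?thesis by (simp add: c'_def d_def)
  qed
  \<comment> \<open>The subtrees are disjoint, so only the first piece contributes at
    \<open>x\<close>.\<close>
  moreover have "c' x \<noteq> 0"
    using below_disjoint[OF xy(1-3)] xy by (auto simp: c'_def d_def below_def)
  moreover from calculation z \<open>supp c' \<subseteq> supp c\<close> have "supp c' \<subset> supp c" "c' \<noteq> 0"
    by (auto simp: supp_def fun_eq_iff)
  ultimately show False using c unfolding elementary_def by blast
qed

text \<open>A clique has at most one upper vertex, so two of three distinct vertices are lower and
  \<open>elementary_lower_pair\<close> applies to them.\<close>

lemma elementary_no_triple:
  assumes "elementary c" "x \<in> clique k" "y \<in> clique k" "z \<in> clique k"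
    and "c x \<noteq> 0" "c y \<noteq> 0" "c z \<noteq> 0"
  shows "x = y \<or> x = z \<or> y = z"
proof -
  consider "x \<in> L k" "y \<in> L k" | "x \<in> L k" "z \<in> L k" | "y \<in> L k" "z \<in> L k"
    | "x \<in> U k" "y \<in> U k" | "x \<in> U k" "z \<in> U k" | "y \<in> U k" "z \<in> U k"
    using assms by (auto simp: clique_def)
  thus ?thesis
    using elementary_lower_pair[OF assms(1), of x k y z] elementary_lower_pair[OF assms(1), of x k z y]
      elementary_lower_pair[OF assms(1), of y k z x] U_unique[of _ k] assms(2-)
    by cases auto
qed

text \<open>Only two terms of the signed clique equation survive, and their signs agree exactly when
  both vertices are lower.\<close>

lemma elementary_pair:
  assumes c: "elementary c" and xy: "x \<in> clique k" "y \<in> clique k" "x \<noteq> y" "c x \<noteq> 0" "c y \<noteq> 0"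
  shows "c y = (if x \<in> L k \<and> y \<in> L k then - c x else c x)"
proof -
  have "c z = 0" if "z \<in> clique k - {x, y}" for z
    using elementary_no_triple[OF c xy(1,2), of z] that xy by blast
  hence "(\<Sum>z\<in>clique k. if z \<in> L k then c z else - c z) = (\<Sum>z\<in>{x, y}. if z \<in> L k then c z else - c z)"
    by (intro sum.mono_neutral_right) (use xy in \<open>auto simp: finite_clique\<close>)
  moreover have "solution c" using c by (simp add: elementary_def)
  ultimately have "(if x \<in> L k then c x else - c x) + (if y \<in> L k then c y else - c y) = 0"
    using clique_eq_0[of c k] xy(3) by simp
  thus ?thesis using U_unique[of x k y] xy
    by (auto simp: clique_def eq_neg_iff_add_eq_0 add.commute split: if_splits)
qed

text \<open>By \<open>elementary_pair\<close>, the property of having the value \<open>c x\<close>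
  or \<open>- c x\<close> spreads through cliques.\<close>

lemma elementary_values:
  assumes c: "elementary c" and "c x \<noteq> 0" "c y \<noteq> 0"
  shows "c y = c x \<or> c y = - c x"
proof -
  have "supp c \<subseteq> {y. c y = c x \<or> c y = - c x}"
  proof (rule elementary_supp_subset[OF c assms(2)])
    fix k u v assume "u \<in> clique k" "v \<in> clique k" "c u \<noteq> 0" "c v \<noteq> 0"
      "u \<in> {y. c y = c x \<or> c y = - c x}"
    thus "v \<in> {y. c y = c x \<or> c y = - c x}"
      using elementary_pair[OF c, of u k v] by (cases "u = v") (auto split: if_splits)
  qed auto
  thus ?thesis using assms by (auto simp: supp_def)
qed

section \<open>Decomposition into elementary solutions\<close>

lemma ex_elementary:
  fixes c :: "'p \<Rightarrow> 'k::field"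
  assumes "solution c" "c \<noteq> 0"
  shows "\<exists>e::'p \<Rightarrow> 'k. elementary e \<and> supp e \<subseteq> supp c"
  using assms
proof (induction "card (supp c)" arbitrary: c rule: less_induct)
  case less
  show ?case
  proof (cases "elementary c")
    case False
    then obtain c' :: "'p \<Rightarrow> 'k" where c': "solution c'" "supp c' \<subset> supp c" "c' \<noteq> 0"
      using less.prems by (auto simp: elementary_def)
    hence "card (supp c') < card (supp c)"
      using finite_supp[OF less.prems(1)] by (simp add: psubset_card_mono)
    from less.hyps[OF this c'(1,3)] c'(2) show ?thesis by blast
  qed blast
qed

lemma elementary_scale:
  assumes "elementary c" "s \<noteq> 0"
  shows "elementary (\<lambda>x. s * c x)"
proof -
  have "supp (\<lambda>x. s * c x) = supp c" using assms by (auto simp: supp_def)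
  moreover have "solution (\<lambda>x. s * c x)"
    using solution_lin_comb[of c 0 s 0] solution_0 assms by (simp add: elementary_def)
  moreover have "(\<lambda>x. s * c x) \<noteq> 0" using assms by (auto simp: elementary_def fun_eq_iff)
  ultimately show ?thesis using assms(1) by (auto simp: elementary_def)
qed

text \<open>Pick an elementary \<open>e\<close> supported inside the support of \<open>c\<close> and
  scale it to the value 1 at some vertex \<open>x\<close>; then \<open>elementary_values\<close>
  confines its values to 0, 1 and -1. Subtracting \<open>c x\<close> times \<open>e\<close> removes
  \<open>x\<close> from the support and adds nothing to it.\<close>

lemma solution_induct [consumes 1, case_names zero add]:
  fixes c :: "'p \<Rightarrow> 'k::field"
  assumes "solution c"
    and zero: "R 0"
    and add: "\<And>s e c. elementary e \<Longrightarrow> range e \<subseteq> {0, 1, -1} \<Longrightarrow> R c \<Longrightarrow> R (\<lambda>x. s * e x + c x)"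
  shows "R c"
  using assms(1)
proof (induction "card (supp c)" arbitrary: c rule: less_induct)
  case less
  show ?case
  proof (cases "c = 0")
    case False
    with less.prems obtain e0 :: "'p \<Rightarrow> 'k" where e0: "elementary e0" "supp e0 \<subseteq> supp c"
      using ex_elementary by blast
    then obtain x where x: "e0 x \<noteq> 0" by (auto simp: elementary_def fun_eq_iff)
    define e where "e y = inverse (e0 x) * e0 y" for y
    have e: "elementary e" "supp e \<subseteq> supp c" "e x = 1"
      using e0 x elementary_scale[OF e0(1), of "inverse (e0 x)"] by (auto simp: e_def[abs_def] supp_def)
    have "range e \<subseteq> {0, 1, -1}" using elementary_values[OF e(1), of x] e(3) by auto
    define c' where "c' y = 1 * c y + (- c x) * e y" for y
    have "solution c'" unfolding c'_def
      using less.prems e(1) by (intro solution_lin_comb) (auto simp: elementary_def)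
    moreover have "x \<in> supp c" "x \<notin> supp c'" "supp c' \<subseteq> supp c"
      using e by (auto simp: supp_def c'_def subset_iff)
    hence "card (supp c') < card (supp c)"
      using finite_supp[OF less.prems] by (intro psubset_card_mono) auto
    ultimately have "R c'" using less.hyps by blast
    from add[OF e(1) \<open>range e \<subseteq> _\<close> this, of "c x"] show ?thesis by (simp add: c'_def)
  qed (use zero in simp)
qed

text \<open>Three different cliques would close a cycle in the forest: each vertex is lower in at
  most one of its two cliques, so each clique would have one upper and one lower vertex of the
  three, and ranks would decrease all the way round. Once two cliques coincide, that clique contains
  all three vertices.\<close>

lemma clique_triple:
  assumes "x \<noteq> y" "y \<noteq> z" "x \<noteq> z" "x \<in> clique k1" "y \<in> clique k1" "y \<in> clique k2" "z \<in> clique k2"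
    and "x \<in> clique k3" "z \<in> clique k3"
  obtains k where "{x, y, z} \<subseteq> clique k"
proof -
  have "x \<in> L k1 \<and> y \<in> L k1 \<or> x \<in> L k1 \<and> y \<in> U k1 \<and> rank y < rank x
      \<or> x \<in> U k1 \<and> y \<in> L k1 \<and> rank x < rank y"
    using assms U_unique[of x k1 y] rank_less by (auto simp: clique_def)
  moreover have "y \<in> L k2 \<and> z \<in> L k2 \<or> y \<in> L k2 \<and> z \<in> U k2 \<and> rank z < rank y
      \<or> y \<in> U k2 \<and> z \<in> L k2 \<and> rank y < rank z"
    using assms U_unique[of y k2 z] rank_less by (auto simp: clique_def)
  moreover have "x \<in> L k3 \<and> z \<in> L k3 \<or> x \<in> L k3 \<and> z \<in> U k3 \<and> rank z < rank x
      \<or> x \<in> U k3 \<and> z \<in> L k3 \<and> rank x < rank z"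
    using assms U_unique[of x k3 z] rank_less by (auto simp: clique_def)
  moreover have "\<not> (x \<in> L k1 \<and> x \<in> L k3)" if "k1 \<noteq> k3" using L_unique that by metis
  moreover have "\<not> (y \<in> L k1 \<and> y \<in> L k2)" if "k1 \<noteq> k2" using L_unique that by metis
  moreover have "\<not> (z \<in> L k2 \<and> z \<in> L k3)" if "k2 \<noteq> k3" using L_unique that by metis
  ultimately have "k1 = k2 \<or> k2 = k3 \<or> k1 = k3" by linarith
  with that assms show thesis by blast
qed

end

section \<open>Cliques of the pullback network\<close>

lemma link_inv_inv [simp]: "link_inv (link_inv l) = l"
  by (cases l) auto

lemma link_proj_inv: "link_proj (link_inv l) = link_inv (link_proj l)"
  by (cases l) auto

lemma link_from_to_inv: "link_from_to N v (link_inv l) u \<longleftrightarrow> link_from_to N u l v"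
  by (cases l) (auto simp: insert_commute)

lemma link_from_to_unique: "link_from_to N u l v \<Longrightarrow> link_from_to N u l v' \<Longrightarrow> v = v'"
  by (cases l) (auto simp: doubleton_eq_iff)

lemma subnetwork_link: "subnetwork M N \<Longrightarrow> link_from_to M u l v \<Longrightarrow> link_from_to N u l v"
  by (cases l) (auto simp: subnetwork_def)

lemma subnetwork_link_verts: "subnetwork M N \<Longrightarrow> link_from_to M u l v \<Longrightarrow> u \<in> verts M \<and> v \<in> verts M"
  by (cases l) (auto simp: subnetwork_def)

lemma traversal_two_iff:
  "traversal N u [l, l'] v \<longleftrightarrow> v \<in> verts N \<and> (\<exists>w. link_from_to N u l w \<and> link_from_to N w l' v) \<and> l' \<noteq> link_inv l"
  by (auto simp: traversal_def less_Suc_eq)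

lemma network_walk_snoc:
  "network_walk N u ls w \<Longrightarrow> link_from_to N w l v \<Longrightarrow> v \<in> verts N \<Longrightarrow> network_walk N u (ls @ [l]) v"
  by (induction ls arbitrary: u) auto

text \<open>Backtracking is cancelled from the end of the walk: a link is prepended to the reduced
  remainder unless that remainder begins with its inverse, in which case both vanish.\<close>

lemma network_walk_imp_traversal: "network_walk N u ls v \<Longrightarrow> \<exists>ls'. traversal N u ls' v"
proof (induction ls arbitrary: u)
  case Nil
  thus ?case by (auto simp: traversal_def intro!: exI[of _ "[]"])
next
  case (Cons l ls)
  then obtain w where w: "link_from_to N u l w" "network_walk N w ls v" by auto
  from Cons.IH[OF w(2)] obtain t where t: "traversal N w t v" by blast
  show ?case
  proof (cases "\<exists>t'. t = link_inv l # t'")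
    case True
    then obtain t' where t': "t = link_inv l # t'" by blast
    with t obtain u' where u': "link_from_to N w (link_inv l) u'" "network_walk N u' t' v"
      by (auto simp: traversal_def)
    with w(1) have "u' = u" using link_from_to_unique link_from_to_inv by metis
    moreover have "t' ! Suc i \<noteq> link_inv (t' ! i)" if "Suc i < length t'" for i
      using t that unfolding t' traversal_def by (auto dest: spec[of _ "Suc i"])
    ultimately show ?thesis using u' by (auto simp: traversal_def)
  next
    case False
    have "(l # t) ! Suc i \<noteq> link_inv ((l # t) ! i)" if "Suc i < length (l # t)" for i
      using that t False by (cases i; cases t) (auto simp: traversal_def)
    with t w show ?thesis by (auto simp: traversal_def intro!: exI[of _ "l # t"])
  qed
qed

section \<open>The pullback network as a forest of cliques\<close>

text \<open>The rooted trees enter through the uniqueness of outgoing arrows and through a rank on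
  the second tree, which ranks a vertex \<open>(n, m)\<close> of the pullback network by
  \<open>m\<close>.\<close>

locale tree_pair =
  T1: fin_digraph T1 + T2: fin_digraph T2
  for T1 :: "('v, 'a) pre_digraph" and T2 :: "('w, 'b) pre_digraph" +
  fixes Q :: "('x, 'c) pre_digraph"
    and F1 :: "('v \<Rightarrow> 'x) \<times> ('a \<Rightarrow> 'c)" and F2 :: "('w \<Rightarrow> 'x) \<times> ('b \<Rightarrow> 'c)"
    and rank :: "'w \<Rightarrow> nat"
  assumes mor1: "quiver_morphism T1 Q F1" and mor2: "quiver_morphism T2 Q F2"
    and out1: "a \<in> arcs T1 \<Longrightarrow> a' \<in> arcs T1 \<Longrightarrow> tail T1 a = tail T1 a' \<Longrightarrow> a = a'"
    and out2: "b \<in> arcs T2 \<Longrightarrow> b' \<in> arcs T2 \<Longrightarrow> tail T2 b = tail T2 b' \<Longrightarrow> b = b'"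
    and rank: "b \<in> arcs T2 \<Longrightarrow> rank (head T2 b) < rank (tail T2 b)"
begin

declare split_paired_Ex [simp del] split_paired_All [simp del]

abbreviation N where "N \<equiv> pullback_network T1 F1 T2 F2"
abbreviation N2 where "N2 \<equiv> covering_network T1 F1 T2 F2"

text \<open>The clique \<open>(n, h, \<gamma>)\<close> carries the condition that the homomorphism commutes with \<open>\<gamma>\<close>, applied to
  the basis vector of \<open>n\<close> and read off at \<open>h\<close>.\<close>

definition low :: "'v \<times> 'w \<times> 'c \<Rightarrow> ('v \<times> 'w) set" where
  "low = (\<lambda>(n, h, \<gamma>). {x \<in> verts N. fst x = n \<and>
     (\<exists>b\<in>arcs T2. tail T2 b = snd x \<and> head T2 b = h \<and> snd F2 b = \<gamma>)})"

definition up :: "'v \<times> 'w \<times> 'c \<Rightarrow> ('v \<times> 'w) set" where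
  "up = (\<lambda>(n, h, \<gamma>). {x \<in> verts N. snd x = h \<and>
     (\<exists>a\<in>arcs T1. tail T1 a = n \<and> head T1 a = fst x \<and> snd F1 a = \<gamma>)})"

lemma N_simps:
  "(n, m) \<in> verts N \<longleftrightarrow> n \<in> verts T1 \<and> m \<in> verts T2 \<and> fst F1 n = fst F2 m"
  "(a, b) \<in> arcs N \<longleftrightarrow> a \<in> arcs T1 \<and> b \<in> arcs T2 \<and> snd F1 a = snd F2 b"
  "tail N (a, b) = (tail T1 a, tail T2 b)" "head N (a, b) = (head T1 a, head T2 b)"
  by (auto simp: pullback_network_def)

lemma N2_simps:
  "(n, m, j) \<in> verts N2 \<longleftrightarrow> (n, m) \<in> verts N \<and> j \<in> {-1, 1}"
  "(a, b, j) \<in> arcs N2 \<longleftrightarrow> (a, b) \<in> arcs N \<and> j \<in> {-1, 1}"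
  "tail N2 (a, b, j) = (tail T1 a, tail T2 b, j)" "head N2 (a, b, j) = (head T1 a, head T2 b, j)"
  "edges N2 = {{(n, m, i), (n, m', -i)} | n m m' i. {(n, m), (n, m')} \<in> edges N \<and> i \<in> {-1, 1}}"
  by (auto simp: covering_network_def Let_def)

lemma finite_verts_N: "finite (verts N)"
  by (rule finite_subset[of _ "verts T1 \<times> verts T2"]) (auto simp: pullback_network_def)

lemma finite_arcs_N: "finite (arcs N)"
  by (rule finite_subset[of _ "arcs T1 \<times> arcs T2"]) (auto simp: pullback_network_def)

lemma low_iff: "(n, m) \<in> low (n', h, \<gamma>) \<longleftrightarrow> (n, m) \<in> verts N \<and> n = n' \<and>
    (\<exists>b\<in>arcs T2. tail T2 b = m \<and> head T2 b = h \<and> snd F2 b = \<gamma>)"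
  by (auto simp: low_def)

lemma up_iff: "(n, m) \<in> up (n', h, \<gamma>) \<longleftrightarrow> (n, m) \<in> verts N \<and> m = h \<and>
    (\<exists>a\<in>arcs T1. tail T1 a = n' \<and> head T1 a = n \<and> snd F1 a = \<gamma>)"
  by (auto simp: up_def)

sublocale forest: clique_forest "verts N" low up "\<lambda>x. rank (snd x)"
proof
  fix x y k k'
  show "x \<in> low k \<Longrightarrow> x \<in> low k' \<Longrightarrow> k = k'"
    using out2 by (cases x; cases k; cases k') (fastforce simp: low_iff)
  show "x \<in> up k \<Longrightarrow> y \<in> up k \<Longrightarrow> x = y"
    using out1 by (cases x; cases y; cases k) (fastforce simp: up_iff)
  show "x \<in> low k \<Longrightarrow> y \<in> up k \<Longrightarrow> rank (snd y) < rank (snd x)"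
    using rank by (cases x; cases y; cases k) (auto simp: low_iff up_iff)
qed (auto simp: low_def up_def finite_verts_N)

abbreviation clique where "clique \<equiv> forest.clique"

lemma arc_verts: "e \<in> arcs N \<Longrightarrow> tail N e \<in> verts N \<and> head N e \<in> verts N"
  using mor1 mor2 by (cases e) (auto simp: N_simps quiver_morphism_def)

lemma arc_clique:
  assumes "e \<in> arcs N"
  obtains k where "tail N e \<in> low k" "head N e \<in> up k"
proof -
  obtain a b where e: "e = (a, b)" by (cases e)
  with assms arc_verts[OF assms] that[of "(tail T1 a, head T2 b, snd F2 b)"] show thesis
    by (auto simp: N_simps(2-) low_iff up_iff)
qed

lemma clique_arc:
  assumes "(n, m) \<in> low k" "(n', m') \<in> up k"
  obtains a b where "(a, b) \<in> arcs N" "tail T1 a = n" "tail T2 b = m" "head T1 a = n'" "head T2 b = m'"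
  using assms by (cases k) (auto simp: low_iff up_iff N_simps)

lemma arc_tail_unique: "e \<in> arcs N \<Longrightarrow> e' \<in> arcs N \<Longrightarrow> tail N e = tail N e' \<Longrightarrow> e = e'"
  using out1 out2 by (cases e; cases e') (auto simp: N_simps)

text \<open>Lower vertices of one clique share the first component, and their second components are
  children of the same vertex via arrows with the same image in \<open>Q\<close>.\<close>

lemma edges_N: "edges N = {{x, y} | x y k. x \<noteq> y \<and> x \<in> low k \<and> y \<in> low k}"
proof (intro equalityI subsetI)
  fix e assume "e \<in> edges N"
  then obtain n m m' b b' where e: "e = {(n, m), (n, m')}" "m \<noteq> m'" "(n, m) \<in> verts N" "(n, m') \<in> verts N"
    "b \<in> out_arcs T2 m" "b' \<in> out_arcs T2 m'" "head T2 b = head T2 b'" "snd F2 b = snd F2 b'"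
    unfolding pullback_network_def by auto
  hence "(n, m) \<in> low (n, head T2 b, snd F2 b)" "(n, m') \<in> low (n, head T2 b, snd F2 b)"
    by (auto simp: low_iff)
  with e show "e \<in> {{x, y} | x y k. x \<noteq> y \<and> x \<in> low k \<and> y \<in> low k}" by blast
next
  fix e assume "e \<in> {{x, y} | x y k. x \<noteq> y \<and> x \<in> low k \<and> y \<in> low k}"
  then obtain x y k where "e = {x, y}" "x \<noteq> y" "x \<in> low k" "y \<in> low k" by blast
  then obtain n m n' m' where e: "e = {(n, m), (n', m')}" "(n, m) \<noteq> (n', m')" "(n, m) \<in> low k" "(n', m') \<in> low k"
    by (cases x; cases y) blast
  obtain n'' h \<gamma> where k: "k = (n'', h, \<gamma>)" by (cases k)
  obtain b b' where "b \<in> arcs T2" "tail T2 b = m" "head T2 b = h" "snd F2 b = \<gamma>"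
    "b' \<in> arcs T2" "tail T2 b' = m'" "head T2 b' = h" "snd F2 b' = \<gamma>" "n = n''" "n' = n''"
    using e(3,4) unfolding k low_iff by blast
  moreover have "n \<in> verts T1" "m \<in> verts T2" "m' \<in> verts T2" "fst F1 n = fst F2 m" "fst F1 n' = fst F2 m'"
    using e(3,4) unfolding k low_iff N_simps by auto
  moreover from calculation have "\<exists>b\<in>out_arcs T2 m. \<exists>b'\<in>out_arcs T2 m'. head T2 b = head T2 b' \<and> snd F2 b = snd F2 b'"
    by (intro bexI[of _ b] bexI[of _ b']) auto
  moreover have "m \<noteq> m'" using e(2) calculation by blast
  ultimately show "e \<in> edges N" using e(1) unfolding pullback_network_def network.simps by blast
qed

text \<open>Arrows and edges are treated alike: both become sets of two vertices, and no such set arises twice.\<close>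

definition links :: "('v \<times> 'w) set set" where
  "links = (\<lambda>e. {tail N e, head N e}) ` arcs N \<union> edges N"

text \<open>An arrow joins a lower to an upper vertex of a clique, an edge joins two lower ones, and
  a pair of upper vertices does not occur.\<close>

lemma links_iff: "x \<noteq> y \<Longrightarrow> {x, y} \<in> links \<longleftrightarrow> (\<exists>k. x \<in> clique k \<and> y \<in> clique k)"
proof
  assume "x \<noteq> y" "{x, y} \<in> links"
  then consider e where "e \<in> arcs N" "{x, y} = {tail N e, head N e}" | "{x, y} \<in> edges N"
    by (auto simp: links_def)
  thus "\<exists>k. x \<in> clique k \<and> y \<in> clique k"
  proof cases
    case 1
    then obtain k where "tail N e \<in> low k" "head N e \<in> up k" by (blast elim: arc_clique)
    hence "tail N e \<in> clique k" "head N e \<in> clique k" by (auto simp: forest.clique_def)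
    with 1 show ?thesis by (metis doubleton_eq_iff)
  next
    case 2
    thus ?thesis by (auto simp: edges_N forest.clique_def doubleton_eq_iff)
  qed
next
  assume xy: "x \<noteq> y" "\<exists>k. x \<in> clique k \<and> y \<in> clique k"
  then obtain k where "x \<in> low k \<and> y \<in> low k \<or> x \<in> low k \<and> y \<in> up k \<or> y \<in> low k \<and> x \<in> up k"
    using forest.U_unique unfolding forest.clique_def by (metis Un_iff)
  moreover have *: "{x, y} \<in> links" if "x \<in> low k" "y \<in> up k" for x y
  proof -
    obtain n m n' m' where xy: "x = (n, m)" "y = (n', m')" by (cases x; cases y)
    with that obtain a b where ab: "(a, b) \<in> arcs N" "tail N (a, b) = x" "head N (a, b) = y"
      by (auto elim!: clique_arc simp: N_simps(3,4))
    show ?thesis unfolding links_def by (rule UnI1, rule image_eqI[OF _ ab(1)]) (simp only: ab)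
  qed
  moreover have "{x, y} \<in> links" if "x \<in> low k" "y \<in> low k"
    using xy that by (auto simp: links_def edges_N)
  moreover have "{x, y} \<in> links" if "y \<in> low k" "x \<in> up k" using *[OF that] by (simp add: insert_commute)
  ultimately show "{x, y} \<in> links" by blast
qed

lemma links_doubleton:
  assumes "e \<in> links"
  obtains x y where "x \<noteq> y" "e = {x, y}"
proof -
  from assms consider e' where "e' \<in> arcs N" "e = {tail N e', head N e'}" | "e \<in> edges N"
    by (auto simp: links_def)
  thus thesis
  proof cases
    case 1
    then obtain k where "tail N e' \<in> low k" "head N e' \<in> up k" by (blast elim: arc_clique)
    hence "tail N e' \<noteq> head N e'" using forest.L_U_disjoint by metis
    with 1 that show thesis by blast
  qed (use that in \<open>auto simp: edges_N\<close>)
qed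

text \<open>The rank tells which end is the tail, and the tail determines the arrow.\<close>

lemma inj_on_arc_ends: "inj_on (\<lambda>e. {tail N e, head N e}) (arcs N)"
proof (rule inj_onI)
  fix e e' assume e: "e \<in> arcs N" "e' \<in> arcs N" "{tail N e, head N e} = {tail N e', head N e'}"
  have less: "rank (snd (head N d)) < rank (snd (tail N d))" if "d \<in> arcs N" for d
    using that rank by (cases d) (auto simp: N_simps)
  have "tail N e = tail N e'"
    using e(3) less[OF e(1)] less[OF e(2)] by (auto simp: doubleton_eq_iff)
  with e show "e = e'" using arc_tail_unique by blast
qed

text \<open>The tail is lower in one clique only, so an edge would make the head lower in the clique
  where it is upper.\<close>

lemma arc_not_edge: "e \<in> arcs N \<Longrightarrow> {tail N e, head N e} \<notin> edges N"
proof
  assume e: "e \<in> arcs N" "{tail N e, head N e} \<in> edges N"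
  from e(1) obtain k where k: "tail N e \<in> low k" "head N e \<in> up k" by (rule arc_clique)
  from e(2) obtain x y k' where "{tail N e, head N e} = {x, y}" "x \<in> low k'" "y \<in> low k'"
    unfolding edges_N by blast
  hence "tail N e \<in> low k'" "head N e \<in> low k'" by (auto simp: doubleton_eq_iff)
  with k show False using forest.L_unique forest.L_U_disjoint by metis
qed

text \<open>The number of arrows and edges in the definition of a triangle becomes a number of
  two-element sets.\<close>

lemma card_links:
  assumes "finite S"
  shows "card {a \<in> arcs N. tail N a \<in> S \<and> head N a \<in> S} + card {e \<in> edges N. e \<subseteq> S}
    = card {e \<in> links. e \<subseteq> S}"
proof -
  let ?f = "\<lambda>e. {tail N e, head N e}" and ?A = "{a \<in> arcs N. tail N a \<in> S \<and> head N a \<in> S}"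
  have "{e \<in> links. e \<subseteq> S} = ?f ` ?A \<union> {e \<in> edges N. e \<subseteq> S}" by (auto simp: links_def)
  moreover have "?f ` ?A \<inter> {e \<in> edges N. e \<subseteq> S} = {}" using arc_not_edge by auto
  moreover have "card (?f ` ?A) = card ?A"
    by (rule card_image) (rule inj_on_subset[OF inj_on_arc_ends], auto)
  moreover have "finite {e \<in> edges N. e \<subseteq> S}" using assms by (auto intro: finite_subset[of _ "Pow S"])
  moreover have "finite ?A" using finite_arcs_N by simp
  ultimately show ?thesis by (simp add: card_Un_disjoint)
qed

text \<open>Three vertices carry at most one link for each of their three pairs, so a triangle means
  that every pair is linked; \<open>clique_triple\<close> then finds a common clique.\<close>

lemma triangle_iff:
  assumes "x \<noteq> y" "y \<noteq> z" "x \<noteq> z"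
  shows "triangle N {x, y, z} \<longleftrightarrow> (\<exists>k. {x, y, z} \<subseteq> clique k)"
proof -
  let ?S = "{x, y, z}" and ?P = "{{x, y}, {y, z}, {x, z}}"
  have "e \<in> ?P" if "e \<in> links" "e \<subseteq> ?S" for e
    using that(1)
  proof (rule links_doubleton)
    fix u v assume "u \<noteq> v" "e = {u, v}"
    with that(2) show ?thesis by (auto simp: doubleton_eq_iff)
  qed
  hence "{e \<in> links. e \<subseteq> ?S} = links \<inter> ?P" by auto
  hence "card {e \<in> links. e \<subseteq> ?S} = 3 \<longleftrightarrow> ?P \<subseteq> links"
  proof -
    assume *: "{e \<in> links. e \<subseteq> ?S} = links \<inter> ?P"
    have "card ?P = 3" using assms by (auto simp: card_insert_if doubleton_eq_iff)
    hence "card (links \<inter> ?P) = 3 \<longleftrightarrow> links \<inter> ?P = ?P"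
      using card_subset_eq[of ?P "links \<inter> ?P"] by auto
    thus ?thesis unfolding * by blast
  qed
  hence "triangle N ?S \<longleftrightarrow> ?S \<subseteq> verts N \<and> ?P \<subseteq> links"
    using assms card_links[of ?S] by (simp add: triangle_def)
  also have "\<dots> \<longleftrightarrow> (\<exists>k. {x, y, z} \<subseteq> clique k)"
  proof
    assume "?S \<subseteq> verts N \<and> ?P \<subseteq> links"
    then obtain k1 k2 k3 where "x \<in> clique k1" "y \<in> clique k1" "y \<in> clique k2" "z \<in> clique k2"
      "x \<in> clique k3" "z \<in> clique k3"
      using assms links_iff[of x y] links_iff[of y z] links_iff[of x z] by blast
    from forest.clique_triple[OF assms this] show "\<exists>k. {x, y, z} \<subseteq> clique k" by blast
  next
    assume "\<exists>k. {x, y, z} \<subseteq> clique k"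
    then obtain k where k: "x \<in> clique k" "y \<in> clique k" "z \<in> clique k" by auto
    moreover have "clique k \<subseteq> verts N"
      using forest.L_P forest.U_P unfolding forest.clique_def by blast
    ultimately show "?S \<subseteq> verts N \<and> ?P \<subseteq> links"
      using assms links_iff[of x y] links_iff[of y z] links_iff[of x z] by blast
  qed
  finally show ?thesis .
qed

lemma link_proj_from_to:
  assumes "link_from_to N2 p l q"
  shows "link_from_to N (forget_sign p) (link_proj l) (forget_sign q)"
proof (cases l)
  case (Arrow a)
  with assms show ?thesis by (cases a) (auto simp: N2_simps N_simps forget_sign_def)
next
  case (Arrow_Inv a)
  with assms show ?thesis by (cases a) (auto simp: N2_simps N_simps forget_sign_def)
next
  case (Edge e)
  with assms show ?thesis
    by (auto simp: N2_simps forget_sign_def doubleton_eq_iff insert_commute)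
qed

text \<open>A forbidden traversal consists of two links, and its middle vertex is determined by the
  first of them. Hence it suffices to inspect pairs of links at a vertex \<open>p\<close> of
  \<open>M\<close>.\<close>

lemma triangle_free_iff:
  assumes M: "subnetwork M N2"
  shows "triangle_free T1 F1 T2 F2 M \<longleftrightarrow>
    (\<forall>p q r l l'. link_from_to M q l p \<and> link_from_to M p l' r \<and>
       l' \<noteq> link_inv l \<and> link_proj l' \<noteq> link_inv (link_proj l) \<longrightarrow>
       \<not> triangle N {forget_sign q, forget_sign p, forget_sign r})" (is "_ \<longleftrightarrow> ?R")
proof
  assume free: "triangle_free T1 F1 T2 F2 M"
  have "\<not> triangle N {forget_sign q, forget_sign p, forget_sign r}"
    if l: "link_from_to M q l p" "link_from_to M p l' r" "l' \<noteq> link_inv l"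
      "link_proj l' \<noteq> link_inv (link_proj l)" for p q r l l'
  proof
    assume tri: "triangle N {forget_sign q, forget_sign p, forget_sign r}"
    have links: "link_from_to N2 q l p" "link_from_to N2 p l' r"
      using l M by (auto intro: subnetwork_link)
    note proj = links[THEN link_proj_from_to]
    have r: "r \<in> verts M" using subnetwork_link_verts[OF M l(2)] by simp
    with l have "traversal M q [l, l'] r" unfolding traversal_two_iff by blast
    moreover have "r \<in> verts N2" using r M by (auto simp: subnetwork_def)
    hence "traversal N2 q [l, l'] r" using links l unfolding traversal_two_iff by blast
    moreover have "traversal N (forget_sign q) [link_proj l, link_proj l'] (forget_sign r)"
      using proj l tri unfolding traversal_two_iff triangle_def by blast
    hence "(forget_sign q, map link_proj [l, l']) \<in> triangle_traversals N"
      using proj tri unfolding triangle_traversals_def by auto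
    ultimately show False using free
      unfolding triangle_free_def covering_triangle_traversals_def by blast
  qed
  thus ?R by blast
next
  assume R: ?R
  show "triangle_free T1 F1 T2 F2 M"
    unfolding triangle_free_def
  proof (intro allI impI notI)
    fix q ls r assume tr: "traversal M q ls r" "(q, ls) \<in> covering_triangle_traversals T1 F1 T2 F2"
    then obtain l l' w v where ls: "map link_proj ls = [l, l']"
      and w: "link_from_to N (forget_sign q) l w" "link_from_to N w l' v"
      and tv: "traversal N (forget_sign q) [l, l'] v" and tri: "triangle N {forget_sign q, w, v}"
      unfolding covering_triangle_traversals_def triangle_traversals_def by auto
    from ls obtain l1 l2 where l: "ls = [l1, l2]" "l = link_proj l1" "l' = link_proj l2" by auto
    with tr obtain p where p: "link_from_to M q l1 p" "link_from_to M p l2 r" "l2 \<noteq> link_inv l1"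
      by (auto simp: traversal_two_iff)
    note proj = p(1,2)[THEN subnetwork_link[OF M], THEN link_proj_from_to, folded l(2,3)]
    have wp: "w = forget_sign p" using link_from_to_unique[OF w(1) proj(1)] .
    moreover have "v = forget_sign r" using link_from_to_unique[OF w(2)] proj(2) wp by blast
    moreover have "link_proj l2 \<noteq> link_inv (link_proj l1)" using tv l by (simp add: traversal_two_iff)
    ultimately show False using R p tri by blast
  qed
qed

text \<open>Arrows keep the sign and edges reverse it. Among the links inside a clique, the edges
  are those with both ends lower.\<close>

lemma link_sign:
  assumes M: "subnetwork M N2" and l: "link_from_to M p l q"
    and p: "forget_sign p \<in> clique k" and q: "forget_sign q \<in> clique k"
  shows "forget_sign p \<noteq> forget_sign q \<and>
    snd (snd q) = (if forget_sign p \<in> low k \<and> forget_sign q \<in> low k then - snd (snd p) else snd (snd p))"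
proof -
  have arrow: "forget_sign p \<noteq> forget_sign q \<and> snd (snd q) = snd (snd p) \<and>
      \<not> (forget_sign p \<in> low k \<and> forget_sign q \<in> low k)"
    if "link_from_to N2 p (Arrow e) q" for e p q
  proof -
    obtain a b j where e: "e = (a, b, j)" by (cases e)
    with that have pq: "(a, b) \<in> arcs N" "forget_sign p = tail N (a, b)" "forget_sign q = head N (a, b)"
      "snd (snd p) = j" "snd (snd q) = j"
      by (auto simp: N2_simps N_simps forget_sign_def)
    obtain k' where "forget_sign p \<in> low k'" "forget_sign q \<in> up k'"
      using pq arc_clique by metis
    thus ?thesis
      using pq(4,5) forest.L_unique[of "forget_sign p" k k'] forest.L_U_disjoint[of "forget_sign q" k']
      by (cases "forget_sign p = forget_sign q") auto
  qed
  have l2: "link_from_to N2 p l q" using M l by (rule subnetwork_link)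
  show ?thesis
  proof (cases l)
    case (Arrow e)
    with arrow[of p e q] l2 show ?thesis by metis
  next
    case (Arrow_Inv e)
    with l2 have "link_from_to N2 q (Arrow e) p" by simp
    from arrow[OF this] show ?thesis by metis
  next
    case (Edge e)
    with l2 obtain n m m' i where e: "{p, q} = {(n, m, i), (n, m', - i)}" "{(n, m), (n, m')} \<in> edges N"
      by (auto simp: N2_simps)
    from e(2) obtain k' where k': "(n, m) \<noteq> (n, m')" "(n, m) \<in> low k'" "(n, m') \<in> low k'"
      unfolding edges_N by (auto simp: doubleton_eq_iff)
    from e(1) have *: "snd (snd q) = - snd (snd p)" "{forget_sign p, forget_sign q} = {(n, m), (n, m')}"
      by (auto simp: doubleton_eq_iff forget_sign_def)
    with k' have ne: "forget_sign p \<noteq> forget_sign q" "forget_sign p \<in> low k'" "forget_sign q \<in> low k'"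
      by (auto simp: doubleton_eq_iff)
    with p q have "forget_sign p \<in> low k \<or> forget_sign q \<in> low k"
      using forest.U_unique unfolding forest.clique_def by (metis Un_iff)
    with ne have "k = k'" using forest.L_unique by blast
    with ne * show ?thesis by simp
  qed
qed

section \<open>Generalized graph maps and solutions\<close>

text \<open>The matrix entry of the associated linear map. For an involution-free subnetwork of
  \<open>N2\<close> the sum has at most one term.\<close>

definition coeff :: "('v \<times> 'w \<times> int, 'a \<times> 'b \<times> int) network \<Rightarrow> 'v \<times> 'w \<Rightarrow> 'k::field" where
  "coeff M x = (\<Sum>j | (fst x, snd x, j) \<in> verts M. of_int j)"

lemma subnetwork_verts:
  assumes "subnetwork M N2" "p \<in> verts M"
  shows "forget_sign p \<in> verts N" "snd (snd p) \<in> {-1, 1}"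
proof -
  have "p \<in> verts N2" using assms by (auto simp: subnetwork_def)
  thus "forget_sign p \<in> verts N" "snd (snd p) \<in> {-1, 1}"
    by (cases p; simp add: N2_simps forget_sign_def)+
qed

lemma finite_verts_subnetwork:
  assumes "subnetwork M N2"
  shows "finite (verts M)"
proof (rule finite_subset)
  show "verts M \<subseteq> (\<lambda>(x, j). (fst x, snd x, j)) ` (verts N \<times> {-1, 1})"
  proof
    fix p assume "p \<in> verts M"
    from subnetwork_verts[OF assms this] show "p \<in> (\<lambda>(x, j). (fst x, snd x, j)) ` (verts N \<times> {-1, 1})"
      by (intro image_eqI[of _ _ "(forget_sign p, snd (snd p))"]) (auto simp: forget_sign_def split: prod.splits)
  qed
qed (simp add: finite_verts_N)

lemma forget_sign_inj:
  assumes "subnetwork M N2" "involution_free M" "p \<in> verts M" "q \<in> verts M"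
    and "forget_sign p = forget_sign q"
  shows "p = q"
proof -
  obtain n m i n' m' j where pq: "p = (n, m, i)" "q = (n', m', j)" by (cases p; cases q)
  with assms(5) have "n' = n" "m' = m" by (auto simp: forget_sign_def)
  moreover have "j \<noteq> - i" using assms(2-4) calculation pq by (auto simp: involution_free_def)
  ultimately show ?thesis
    using subnetwork_verts(2)[OF assms(1,3)] subnetwork_verts(2)[OF assms(1,4)] pq by auto
qed

section \<open>The matching of a generalized graph map within a clique\<close>

text \<open>Two different partners would lie over different vertices and form a triangle with
  \<open>p\<close> in the clique; passing from one to the other through \<open>p\<close> would be a
  forbidden traversal.\<close>

lemma mate_unique:
  assumes M: "subnetwork M N2" "involution_free M" "triangle_free T1 F1 T2 F2 M"
    and l: "link_from_to M p l q" "link_from_to M p l' q'"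
    and k: "forget_sign p \<in> clique k" "forget_sign q \<in> clique k" "forget_sign q' \<in> clique k"
  shows "q = q'"
proof (rule ccontr)
  assume ne: "q \<noteq> q'"
  have "q \<in> verts M" "q' \<in> verts M" using l subnetwork_link_verts[OF M(1)] by blast+
  hence qq': "forget_sign q \<noteq> forget_sign q'" using forget_sign_inj M ne by blast
  have pq: "forget_sign p \<noteq> forget_sign q" "forget_sign p \<noteq> forget_sign q'"
    using link_sign[OF M(1)] l k by blast+
  have "link_proj l' \<noteq> link_proj l"
    using qq' link_proj_from_to subnetwork_link[OF M(1)] l link_from_to_unique by metis
  moreover have "l' \<noteq> l" using ne l link_from_to_unique by metis
  moreover have "triangle N {forget_sign q, forget_sign p, forget_sign q'}"
    using triangle_iff[of "forget_sign q" "forget_sign p" "forget_sign q'"] pq qq' k by auto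
  moreover have "link_from_to M q (link_inv l) p" using l(1) by (simp add: link_from_to_inv)
  ultimately show False
    using l(2) M(3) unfolding triangle_free_iff[OF M(1)] by (metis link_inv_inv link_proj_inv)
qed

text \<open>Condition (i) of completeness serves the cliques in which \<open>p\<close> is upper,
  condition (ii) those in which \<open>p\<close> is lower.\<close>

lemma mate_exists:
  assumes M: "subnetwork M N2" "network_complete T1 F1 T2 F2 M"
    and p: "p \<in> verts M" "forget_sign p \<in> clique k"
  obtains q l where "q \<in> verts M" "forget_sign q \<in> clique k" "link_from_to M p l q"
proof -
  obtain n m j where p': "p = (n, m, j)" by (cases p)
  obtain n' h \<gamma> where k: "k = (n', h, \<gamma>)" by (cases k)
  have arc: "(tail T1 a, tail T2 b, j) \<in> verts M" "(head T1 a, head T2 b, j) \<in> verts M"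
    "snd F1 a = snd F2 b" "a \<in> arcs T1" "b \<in> arcs T2"
    "link_from_to M (tail T1 a, tail T2 b, j) (Arrow (a, b, j)) (head T1 a, head T2 b, j)"
    if "(a, b, j) \<in> arcs M" for a b
  proof -
    have "(a, b, j) \<in> arcs N2" "tail M = tail N2" "head M = head N2"
      using that M by (auto simp: subnetwork_def)
    with that show "link_from_to M (tail T1 a, tail T2 b, j) (Arrow (a, b, j)) (head T1 a, head T2 b, j)"
      "snd F1 a = snd F2 b" "a \<in> arcs T1" "b \<in> arcs T2"
      by (simp_all add: N2_simps N_simps)
    thus "(tail T1 a, tail T2 b, j) \<in> verts M" "(head T1 a, head T2 b, j) \<in> verts M"
      using subnetwork_link_verts[OF M(1)] by blast+
  qed
  have vN: "(n, m) \<in> verts N" if "(n, m, j) \<in> verts M" for n m j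
    using subnetwork_verts(1)[OF M(1) that] by (simp add: forget_sign_def)
  from p(2) p' consider "(n, m) \<in> low k" | "(n, m) \<in> up k" by (auto simp: forest.clique_def forget_sign_def)
  thus thesis
  proof cases
    case 1
    then obtain b where b: "n = n'" "b \<in> out_arcs T2 m" "head T2 b = h" "snd F2 b = \<gamma>"
      unfolding k low_iff by auto
    from M(2) p(1) b(2) p' consider a where "a \<in> out_arcs T1 n" "(a, b, j) \<in> arcs M"
      | b'' where "b'' \<in> in_arcs T2 (head T2 b)" "snd F2 b = snd F2 b''"
          "(n, tail T2 b'', -j) \<in> verts M" "{(n, m, j), (n, tail T2 b'', -j)} \<in> edges M"
      unfolding network_complete_def by blast
    thus thesis
    proof cases
      case (1 a)
      note a = arc[OF 1(2)]
      have "(head T1 a, head T2 b) \<in> up k"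
        using 1 b a(3,4) vN[OF a(2)] by (auto simp: k up_iff)
      moreover have "link_from_to M p (Arrow (a, b, j)) (head T1 a, head T2 b, j)"
        using a(6) 1(1) b(2) p' by simp
      ultimately show thesis
        using that[OF a(2)] by (simp add: forget_sign_def forest.clique_def del: link_from_to.simps)
    next
      case (2 b'')
      have "(n, tail T2 b'') \<in> low k"
        using 2 b vN[OF 2(3)] by (auto simp: k low_iff)
      thus thesis using that[of "(n, tail T2 b'', - j)" "Edge {(n, m, j), (n, tail T2 b'', -j)}"] 2 p'
        by (simp add: forget_sign_def forest.clique_def)
    qed
  next
    case 2
    then obtain a where a: "m = h" "a \<in> in_arcs T1 n" "tail T1 a = n'" "snd F1 a = \<gamma>"
      unfolding k up_iff by auto
    with M(2) p(1) p' obtain b where b: "b \<in> in_arcs T2 m" "(a, b, j) \<in> arcs M"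
      unfolding network_complete_def by blast
    note ab = arc[OF b(2)]
    have "(tail T1 a, tail T2 b) \<in> low k"
      using a b ab(3,5) vN[OF ab(1)] by (auto simp: k low_iff)
    moreover have "link_from_to M p (link_inv (Arrow (a, b, j))) (tail T1 a, tail T2 b, j)"
      using ab(6) a(2) b(1) p' unfolding link_from_to_inv by simp
    ultimately show thesis
      using that[OF ab(1)] by (simp add: forget_sign_def forest.clique_def del: link_from_to.simps link_inv.simps)
  qed
qed

text \<open>In every clique, matching each vertex of the map with the one it is linked to is an involution, and it
  negates the contribution to the equation of the clique.\<close>

lemma generalized_graph_map_solution:
  assumes char: "(2 :: 'k::field) \<noteq> 0" and M: "generalized_graph_map T1 F1 T2 F2 M"
  shows "forest.solution (coeff M :: _ \<Rightarrow> 'k)"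
proof -
  have sub: "subnetwork M N2" and inv: "involution_free M" and tri: "triangle_free T1 F1 T2 F2 M"
    and compl: "network_complete T1 F1 T2 F2 M"
    using M by (auto simp: generalized_graph_map_def)
  have fin: "finite (verts M)" using sub by (rule finite_verts_subnetwork)
  have supp: "supp (coeff M :: _ \<Rightarrow> 'k) \<subseteq> verts N"
  proof
    fix x assume "x \<in> supp (coeff M :: _ \<Rightarrow> 'k)"
    then obtain j where "(fst x, snd x, j) \<in> verts M"
      by (auto simp: supp_def coeff_def elim: sum.not_neutral_contains_not_neutral)
    from subnetwork_verts(1)[OF sub this] show "x \<in> verts N" by (simp add: forget_sign_def)
  qed
  have "sum (coeff M) (low k) = (sum (coeff M) (up k) :: 'k)" for k
  proof -
    define Z where "Z = {p \<in> verts M. forget_sign p \<in> clique k}"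
    \<comment> \<open>The contribution of \<open>p\<close> to the signed equation of the
      clique.\<close>
    define s where "s p = (if forget_sign p \<in> low k then of_int (snd (snd p)) else - of_int (snd (snd p)) :: 'k)" for p :: "'v \<times> 'w \<times> int"
    define mate where "mate p = (SOME q. q \<in> Z \<and> (\<exists>l. link_from_to M p l q))" for p
    have mate: "mate p \<in> Z \<and> (\<exists>l. link_from_to M p l (mate p))" if "p \<in> Z" for p
    proof -
      from that obtain q l where "q \<in> verts M" "forget_sign q \<in> clique k" "link_from_to M p l q"
        unfolding Z_def using mate_exists[OF sub compl] by blast
      hence "\<exists>q. q \<in> Z \<and> (\<exists>l. link_from_to M p l q)" by (auto simp: Z_def)
      thus ?thesis unfolding mate_def by (rule someI_ex)
    qed
    \<comment> \<open>The inverse link leads from \<open>mate p\<close> back to \<open>p\<close>,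
      and partners are unique.\<close>
    have mate_mate: "mate (mate p) = p" if p: "p \<in> Z" for p
    proof -
      from mate[OF p] obtain l where l: "mate p \<in> Z" "link_from_to M p l (mate p)" by blast
      from mate[OF l(1)] obtain l' where l': "mate (mate p) \<in> Z" "link_from_to M (mate p) l' (mate (mate p))" by blast
      from l(2) have "link_from_to M (mate p) (link_inv l) p" by (simp add: link_from_to_inv)
      from mate_unique[OF sub inv tri this l'(2), of k] p l l' show ?thesis by (auto simp: Z_def)
    qed
    have s_mate: "s (mate p) = - s p" if p: "p \<in> Z" for p
    proof -
      from mate[OF p] obtain l where l: "mate p \<in> Z" "link_from_to M p l (mate p)" by blast
      from link_sign[OF sub l(2), of k] p l(1)
      have "forget_sign p \<noteq> forget_sign (mate p)"
        and *: "snd (snd (mate p)) = (if forget_sign p \<in> low k \<and> forget_sign (mate p) \<in> low k then - snd (snd p) else snd (snd p))"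
        and "forget_sign p \<in> clique k" "forget_sign (mate p) \<in> clique k"
        by (auto simp: Z_def)
      hence "forget_sign p \<in> low k \<or> forget_sign (mate p) \<in> low k"
        using forest.U_unique unfolding forest.clique_def by (metis Un_iff)
      with * show ?thesis by (auto simp: s_def)
    qed
    \<comment> \<open>Reindexing along the involution shows that the sum equals its own negative; as
      2 is invertible, it vanishes.\<close>
    have "(\<Sum>p\<in>Z. s p) = (\<Sum>p\<in>Z. s (mate p))"
      by (rule sum.reindex_bij_witness[of _ mate mate]) (use mate mate_mate in auto)
    also have "\<dots> = - (\<Sum>p\<in>Z. s p)" by (simp add: s_mate sum_negf)
    finally have "2 * (\<Sum>p\<in>Z. s p) = 0" by (metis add.right_inverse mult_2)
    hence 0: "(\<Sum>p\<in>Z. s p) = 0" using char by simp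
    \<comment> \<open>Groups the vertices of \<open>M\<close> according to the vertices of the
      pullback network under them.\<close>
    have part: "(\<Sum>p | p \<in> verts M \<and> forget_sign p \<in> A. of_int (snd (snd p))) = (sum (coeff M) A :: 'k)"
      if "finite A" for A
    proof -
      have "(\<Sum>p | p \<in> verts M \<and> forget_sign p \<in> A. of_int (snd (snd p)) :: 'k)
          = (\<Sum>(x, j)\<in>(SIGMA x:A. {j. (fst x, snd x, j) \<in> verts M}). of_int j)"
        by (rule sum.reindex_bij_witness[of _ "\<lambda>(x, j). (fst x, snd x, j)" "\<lambda>p. (forget_sign p, snd (snd p))"])
          (auto simp: forget_sign_def split: prod.splits)
      also have "\<dots> = sum (coeff M) A"
        unfolding coeff_def
      proof (rule sum.Sigma[symmetric])
        show "\<forall>x\<in>A. finite {j. (fst x, snd x, j) \<in> verts M}"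
        proof
          fix x
          have "{j. (fst x, snd x, j) \<in> verts M} \<subseteq> (\<lambda>p. snd (snd p)) ` verts M" by force
          thus "finite {j. (fst x, snd x, j) \<in> verts M}" using fin finite_surj by blast
        qed
      qed (rule that)
      finally show ?thesis .
    qed
    have Z: "Z = {p. p \<in> verts M \<and> forget_sign p \<in> low k} \<union> {p. p \<in> verts M \<and> forget_sign p \<in> up k}"
      by (auto simp: Z_def forest.clique_def)
    have "(\<Sum>p\<in>Z. s p) = (\<Sum>p | p \<in> verts M \<and> forget_sign p \<in> low k. s p)
        + (\<Sum>p | p \<in> verts M \<and> forget_sign p \<in> up k. s p)"
      unfolding Z
    proof (rule sum.union_disjoint)
      show "{p \<in> verts M. forget_sign p \<in> low k} \<inter> {p \<in> verts M. forget_sign p \<in> up k} = {}"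
        using forest.L_U_disjoint[of _ k] by blast
    qed (use fin in simp_all)
    also have "(\<Sum>p | p \<in> verts M \<and> forget_sign p \<in> low k. s p)
        = (\<Sum>p | p \<in> verts M \<and> forget_sign p \<in> low k. of_int (snd (snd p)))"
      by (rule sum.cong) (auto simp: s_def)
    also have "(\<Sum>p | p \<in> verts M \<and> forget_sign p \<in> up k. s p)
        = (\<Sum>p | p \<in> verts M \<and> forget_sign p \<in> up k. - of_int (snd (snd p)))"
    proof (rule sum.cong)
      fix p assume "p \<in> {p \<in> verts M. forget_sign p \<in> up k}"
      hence "forget_sign p \<notin> low k" using forest.L_U_disjoint by blast
      thus "s p = - of_int (snd (snd p))" by (simp add: s_def)
    qed simp
    finally show ?thesis
      using 0 by (simp add: sum_negf part forest.finite_L forest.finite_U)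
  qed
  with supp show ?thesis by (auto simp: forest.solution_def)
qed

section \<open>From elementary solutions to generalized graph maps\<close>

text \<open>Meant for solutions with values in \<open>{0, 1, -1}\<close>.\<close>

definition support_network :: "('v \<times> 'w \<Rightarrow> 'k::field) \<Rightarrow> ('v \<times> 'w \<times> int, 'a \<times> 'b \<times> int) network" where
  "support_network c = (let V = {p \<in> verts N2. c (forget_sign p) = of_int (snd (snd p))} in
    \<lparr> verts = V, arcs = {a \<in> arcs N2. tail N2 a \<in> V \<and> head N2 a \<in> V},
      tail = tail N2, head = head N2, edges = {e \<in> edges N2. e \<subseteq> V} \<rparr>)"

lemma support_network_simps:
  "verts (support_network c) = {p \<in> verts N2. c (forget_sign p) = of_int (snd (snd p))}"
  "arcs (support_network c) = {a \<in> arcs N2. tail N2 a \<in> verts (support_network c) \<and> head N2 a \<in> verts (support_network c)}"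
  "tail (support_network c) = tail N2" "head (support_network c) = head N2"
  "edges (support_network c) = {e \<in> edges N2. e \<subseteq> verts (support_network c)}"
  by (simp_all add: support_network_def Let_def)

lemma subnetwork_support_network: "subnetwork (support_network c) N2"
  by (auto simp: subnetwork_def support_network_simps)

lemma support_network_vert_iff:
  "(n, m, j) \<in> verts (support_network c) \<longleftrightarrow> (n, m) \<in> verts N \<and> j \<in> {-1, 1} \<and> c (n, m) = of_int j"
  by (auto simp: support_network_simps(1) N2_simps forget_sign_def)

context
  fixes c :: "'v \<times> 'w \<Rightarrow> 'k::field"
  assumes char: "(2 :: 'k) \<noteq> 0" and c: "forest.elementary c" "range c \<subseteq> {0, 1, -1}"
begin

lemma one_neq: "(1 :: 'k) \<noteq> - 1"
  using char by (metis one_add_one eq_neg_iff_add_eq_0)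

lemma solution_c: "forest.solution c"
  using c by (simp add: forest.elementary_def)

lemma support_network_nonzero: "(n, m, j) \<in> verts (support_network c) \<Longrightarrow> c (n, m) \<noteq> 0"
  by (auto simp: support_network_vert_iff)

lemma support_network_vertI: "c (n, m) \<noteq> 0 \<Longrightarrow> c (n, m) = of_int j \<Longrightarrow> j \<in> {-1, 1} \<Longrightarrow> (n, m, j) \<in> verts (support_network c)"
  using solution_c by (auto simp: forest.solution_def supp_def support_network_vert_iff)

lemma coeff_support_network: "coeff (support_network c) = c"
proof
  fix x :: "'v \<times> 'w"
  obtain n m where x: "x = (n, m)" by (cases x)
  have "c x \<in> {0, 1, -1}" using c(2) by auto
  moreover have "x \<in> verts N" if "c x \<noteq> 0" using solution_c that by (auto simp: forest.solution_def supp_def)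
  ultimately have "{j. (n, m, j) \<in> verts (support_network c)} = (if c x = 1 then {1} else if c x = -1 then {-1} else {})"
    using one_neq by (auto simp: support_network_vert_iff x)
  with \<open>c x \<in> _\<close> show "coeff (support_network c) x = c x"
    using one_neq by (auto simp: coeff_def x)
qed

text \<open>An elementary solution has equal values at a lower and an upper vertex of its support in
  one clique, so both are lifted with the same sign, whichever of the two lifts is given.\<close>

lemma support_network_arc:
  assumes "(n, m) \<in> low k" "(n', m') \<in> up k" "c (n, m) \<noteq> 0" "c (n', m') \<noteq> 0"
    and "(n, m, j) \<in> verts (support_network c) \<or> (n', m', j) \<in> verts (support_network c)"
  obtains a b where "(a, b, j) \<in> arcs (support_network c)" "a \<in> arcs T1" "b \<in> arcs T2"
    "tail T1 a = n" "tail T2 b = m" "head T1 a = n'" "head T2 b = m'"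
    "(n, m, j) \<in> verts (support_network c)" "(n', m', j) \<in> verts (support_network c)"
proof -
  obtain a b where ab: "(a, b) \<in> arcs N" "tail T1 a = n" "tail T2 b = m" "head T1 a = n'" "head T2 b = m'"
    using clique_arc[OF assms(1,2)] by blast
  have "(n, m) \<noteq> (n', m')" using forest.L_U_disjoint[OF assms(1)] assms(2) by metis
  hence "c (n', m') = c (n, m)"
    using forest.elementary_pair[OF c(1), of "(n, m)" k "(n', m')"] assms forest.L_U_disjoint[of "(n', m')" k]
    by (auto simp: forest.clique_def split: if_splits)
  with assms have "(n, m, j) \<in> verts (support_network c)" "(n', m', j) \<in> verts (support_network c)"
    by (intro support_network_vertI; auto simp: support_network_vert_iff)+
  moreover from this have "(a, b, j) \<in> arcs (support_network c)"
    using ab by (simp add: support_network_simps(2) N2_simps support_network_vert_iff)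
  ultimately show thesis using ab that by (auto simp: N_simps)
qed

text \<open>Two lower vertices of the support in one clique have opposite values and hence opposite
  signs.\<close>

lemma support_network_edge:
  assumes "(n, m) \<in> low k" "(n', m') \<in> low k" "(n, m) \<noteq> (n', m')" "c (n', m') \<noteq> 0"
    and p: "(n, m, j) \<in> verts (support_network c)"
  shows "n' = n" "(n, m', -j) \<in> verts (support_network c)"
    "{(n, m, j), (n, m', -j)} \<in> edges (support_network c)"
proof -
  show n: "n' = n" using assms(1,2) by (cases k) (auto simp: low_iff)
  have "c (n', m') = - c (n, m)"
    using forest.elementary_pair[OF c(1), of "(n, m)" k "(n', m')"] assms support_network_nonzero[OF p]
    by (auto simp: forest.clique_def)
  with p assms(4) n show v: "(n, m', -j) \<in> verts (support_network c)"
    by (intro support_network_vertI; auto simp: support_network_vert_iff)+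
  have "{(n, m), (n, m')} \<in> edges N" unfolding edges_N using assms(1-3) n by blast
  with p v show "{(n, m, j), (n, m', -j)} \<in> edges (support_network c)"
    unfolding support_network_simps(5) N2_simps(5)
    by (auto simp only: mem_Collect_eq empty_subsetI insert_subset support_network_vert_iff[of n m j])
qed

lemma support_network_complete: "network_complete T1 F1 T2 F2 (support_network c)"
  unfolding network_complete_def
proof (intro allI impI conjI ballI)
  fix n m j a assume p: "(n, m, j) \<in> verts (support_network c)" and a: "a \<in> in_arcs T1 n"
  \<comment> \<open>In this clique \<open>(n, m)\<close> is upper, so the second vertex of the
    support found there is lower and yields the arrow.\<close>
  define k where "k = (tail T1 a, m, snd F1 a)"
  have up: "(n, m) \<in> up k" using a p by (auto simp: k_def up_iff support_network_vert_iff)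
  hence "(n, m) \<in> clique k" by (simp add: forest.clique_def)
  from forest.clique_other[OF solution_c this support_network_nonzero[OF p]]
  obtain y where y: "y \<in> clique k" "y \<noteq> (n, m)" "c y \<noteq> 0" .
  with up have "y \<in> low k" using forest.U_unique unfolding forest.clique_def by (metis Un_iff)
  moreover obtain n' m' where y': "y = (n', m')" by (cases y)
  ultimately obtain a' b where ab: "(a', b, j) \<in> arcs (support_network c)" "a' \<in> arcs T1" "b \<in> arcs T2"
    "tail T1 a' = n'" "head T2 b = m"
    using support_network_arc[of n' m' k n m j] up y p support_network_nonzero[OF p] by metis
  moreover have "n' = tail T1 a" using \<open>y \<in> low k\<close> by (simp add: k_def y' low_iff)
  hence "a' = a" using out1 ab a by auto
  ultimately show "\<exists>b\<in>in_arcs T2 m. (a, b, j) \<in> arcs (support_network c)" by auto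
next
  fix n m j b assume p: "(n, m, j) \<in> verts (support_network c)" and b: "b \<in> out_arcs T2 m"
  \<comment> \<open>In this clique \<open>(n, m)\<close> is lower; a second vertex of the support
    yields an arrow if it is upper and an edge if it is lower.\<close>
  define k where "k = (n, head T2 b, snd F2 b)"
  have low: "(n, m) \<in> low k" using b p by (auto simp: k_def low_iff support_network_vert_iff)
  hence "(n, m) \<in> clique k" by (simp add: forest.clique_def)
  from forest.clique_other[OF solution_c this support_network_nonzero[OF p]]
  obtain y where y: "y \<in> clique k" "y \<noteq> (n, m)" "c y \<noteq> 0" .
  obtain n' m' where y': "y = (n', m')" by (cases y)
  from y(1) consider "y \<in> up k" | "y \<in> low k" by (auto simp: forest.clique_def)
  thus "(\<exists>a\<in>out_arcs T1 n. (a, b, j) \<in> arcs (support_network c)) \<or>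
      (\<exists>b''\<in>in_arcs T2 (head T2 b). snd F2 b = snd F2 b'' \<and>
         (n, tail T2 b'', - j) \<in> verts (support_network c) \<and>
         {(n, m, j), (n, tail T2 b'', - j)} \<in> edges (support_network c))"
  proof cases
    case 1
    then obtain a b' where ab: "(a, b', j) \<in> arcs (support_network c)" "a \<in> arcs T1" "b' \<in> arcs T2"
      "tail T1 a = n" "tail T2 b' = m"
      using support_network_arc[of n m k n' m' j] low y y' p support_network_nonzero[OF p] by metis
    moreover have "b' = b" using out2 ab b by auto
    ultimately show ?thesis by auto
  next
    case 2
    then obtain b'' where b'': "b'' \<in> in_arcs T2 (head T2 b)" "tail T2 b'' = m'" "snd F2 b'' = snd F2 b"
      by (auto simp: k_def y' low_iff)
    from 2 y y' support_network_edge[OF low, of n' m' j] p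
    have "(n, m', -j) \<in> verts (support_network c)" "{(n, m, j), (n, m', -j)} \<in> edges (support_network c)"
      by auto
    with b'' show ?thesis by auto
  qed
qed

lemma support_network_involution_free: "involution_free (support_network c)"
  using one_neq by (auto simp: involution_free_def support_network_vert_iff)

text \<open>A triangle would put three vertices of the support into one clique, against
  \<open>elementary_no_triple\<close>.\<close>

lemma support_network_triangle_free: "triangle_free T1 F1 T2 F2 (support_network c)"
  unfolding triangle_free_iff[OF subnetwork_support_network]
proof (intro allI impI notI)
  fix p q r l l'
  assume l: "link_from_to (support_network c) q l p \<and> link_from_to (support_network c) p l' r \<and>
      l' \<noteq> link_inv l \<and> link_proj l' \<noteq> link_inv (link_proj l)"
    and tri: "triangle N {forget_sign q, forget_sign p, forget_sign r}"
  have "card {forget_sign q, forget_sign p, forget_sign r} = 3" using tri by (simp add: triangle_def)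
  hence ne: "forget_sign q \<noteq> forget_sign p" "forget_sign p \<noteq> forget_sign r" "forget_sign q \<noteq> forget_sign r"
    by (auto simp: card_insert_if split: if_splits)
  with tri triangle_iff obtain k where "{forget_sign q, forget_sign p, forget_sign r} \<subseteq> clique k" by blast
  moreover have "c (forget_sign v) \<noteq> 0" if "v \<in> verts (support_network c)" for v
    using that by (cases v) (auto simp: forget_sign_def dest: support_network_nonzero)
  hence "c (forget_sign q) \<noteq> 0" "c (forget_sign p) \<noteq> 0" "c (forget_sign r) \<noteq> 0"
    using l subnetwork_link_verts[OF subnetwork_support_network] by blast+
  ultimately show False using forest.elementary_no_triple[OF c(1)] ne by blast
qed

text \<open>The set of vertices over which some walk from \<open>u\<close> ends spreads through
  cliques, so it contains the whole support.\<close>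

lemma support_network_connected: "network_connected (support_network c)"
  unfolding network_connected_def
proof (intro ballI)
  let ?G = "support_network c"
  fix u v assume u: "u \<in> verts ?G" and v: "v \<in> verts ?G"
  define A where "A = {x. \<exists>j ls. network_walk ?G u ls (fst x, snd x, j)}"
  have walk_verts: "w \<in> verts ?G" if "network_walk ?G u ls w" for ls w u
    using that by (induction ls arbitrary: u) auto
  have nonzero: "c (forget_sign v) \<noteq> 0" if "v \<in> verts (support_network c)" for v
    using that by (cases v) (auto simp: forget_sign_def dest: support_network_nonzero)
  have "supp c \<subseteq> A"
  proof (rule forest.elementary_supp_subset[OF c(1) nonzero[OF u]])
    have "network_walk ?G u [] u" using u by simp
    thus "forget_sign u \<in> A" unfolding A_def forget_sign_def by (cases u) (auto simp del: network_walk.simps)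
  next
    fix k x y assume xy: "x \<in> clique k" "y \<in> clique k" "c x \<noteq> 0" "c y \<noteq> 0" and "x \<in> A"
    obtain n m n' m' where xy': "x = (n, m)" "y = (n', m')" by (cases x; cases y)
    from \<open>x \<in> A\<close> obtain j ls where ls: "network_walk ?G u ls (n, m, j)" by (auto simp: A_def xy')
    hence x: "(n, m, j) \<in> verts ?G" by (rule walk_verts)
    have "y \<in> A" if ne: "x \<noteq> y"
    proof -
      have "\<exists>j' l. (n', m', j') \<in> verts ?G \<and> link_from_to ?G (n, m, j) l (n', m', j')"
      proof -
        consider "x \<in> low k" "y \<in> low k" | "x \<in> low k" "y \<in> up k" | "x \<in> up k" "y \<in> low k"
          using forest.clique_pair[OF xy(1,2) ne] by blast
        thus ?thesis
        proof cases
          case 1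
          from support_network_edge[of n m k n' m' j] 1 xy xy' ne x
          have "n' = n" "(n, m', -j) \<in> verts ?G" "{(n, m, j), (n, m', -j)} \<in> edges ?G" by auto
          thus ?thesis by (intro exI[of _ "-j"] exI[of _ "Edge _"]) auto
        next
          case 2
          from support_network_arc[of n m k n' m' j] 2 xy xy' x
          obtain a b where "(a, b, j) \<in> arcs ?G" "tail T1 a = n" "tail T2 b = m" "head T1 a = n'" "head T2 b = m'"
            "(n', m', j) \<in> verts ?G" by metis
          thus ?thesis
            by (intro exI[of _ j] exI[of _ "Arrow (a, b, j)"]) (auto simp: support_network_simps(3,4) N2_simps)
        next
          case 3
          from support_network_arc[of n' m' k n m j] 3 xy xy' x
          obtain a b where "(a, b, j) \<in> arcs ?G" "tail T1 a = n'" "tail T2 b = m'" "head T1 a = n" "head T2 b = m"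
            "(n', m', j) \<in> verts ?G" by metis
          thus ?thesis
            by (intro exI[of _ j] exI[of _ "Arrow_Inv (a, b, j)"]) (auto simp: support_network_simps(3,4) N2_simps)
        qed
      qed
      with network_walk_snoc[OF ls] have "\<exists>j' ls'. network_walk ?G u ls' (n', m', j')" by blast
      thus ?thesis by (auto simp: A_def xy')
    qed
    with \<open>x \<in> A\<close> show "y \<in> A" by blast
  qed
  with nonzero[OF v] have "forget_sign v \<in> A" by (auto simp: supp_def)
  then obtain j ls where ls: "network_walk ?G u ls (fst (forget_sign v), snd (forget_sign v), j)"
    by (auto simp: A_def)
  \<comment> \<open>The walk ends at some lift of \<open>forget_sign v\<close>; as the network is
    involution-free, this lift is \<open>v\<close>.\<close>
  from forget_sign_inj[OF subnetwork_support_network support_network_involution_free walk_verts[OF ls] v]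
  have "(fst (forget_sign v), snd (forget_sign v), j) = v" by (simp add: forget_sign_def)
  with ls show "\<exists>ls. traversal ?G u ls v" using network_walk_imp_traversal by metis
qed

lemma support_network_generalized_graph_map: "generalized_graph_map T1 F1 T2 F2 (support_network c)"
proof -
  obtain x where "c x \<noteq> 0" using c(1) by (auto simp: forest.elementary_def fun_eq_iff)
  moreover have "c x \<in> {0, 1, -1}" using c(2) by auto
  ultimately have "(fst x, snd x, if c x = 1 then 1 else -1) \<in> verts (support_network c)"
    by (intro support_network_vertI) auto
  thus ?thesis
    unfolding generalized_graph_map_def
    using subnetwork_support_network support_network_complete support_network_connected
      support_network_triangle_free support_network_involution_free by blast
qed

end

end

section \<open>Homomorphisms and solutions\<close>

lemma linear_ext_sum:
  "linear_ext T g (\<Sum>i\<in>A. u i) = (\<Sum>i\<in>A. linear_ext T g (u i))"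
proof (induction A rule: infinite_finite_induct)
  case (insert i A)
  thus ?case by (simp only: sum.insert linear_ext_add not_False_eq_True)
qed (rule ext, simp add: linear_ext_apply)+

lemma arrow_act_apply:
  assumes T: "fin_digraph T"
  shows "arrow_act T F \<gamma> v m = (\<Sum>a | a \<in> arcs T \<and> snd F a = \<gamma> \<and> head T a = m. v (tail T a) :: 'k::field)"
proof -
  interpret fin_digraph T by (rule T)
  let ?A = "{a \<in> arcs T. snd F a = \<gamma>}"
  have "arrow_act T F \<gamma> v m
      = (\<Sum>n\<in>verts T. \<Sum>a | a \<in> ?A \<and> tail T a = n. v (tail T a) * of_bool (m = head T a))"
    unfolding arrow_act_def linear_ext_apply sum_fun_apply sum_distrib_left basis_vec_def
    by (intro sum.cong) auto
  also have "\<dots> = (\<Sum>a\<in>?A. v (tail T a) * of_bool (m = head T a))"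
    by (rule sum.group) auto
  also have "\<dots> = (\<Sum>a | a \<in> arcs T \<and> snd F a = \<gamma> \<and> head T a = m. v (tail T a))"
    by (intro sum.mono_neutral_cong_right) auto
  finally show ?thesis .
qed

text \<open>Writes the cosets in the form to which \<open>tree_module_act\<close> applies.\<close>

lemma bound_quiver_algebra_eq:
  "bound_quiver_algebra Q \<rho> = (\<lambda>g. {h \<in> path_algebra Q. g - h \<in> relation_ideal Q \<rho>}) ` path_algebra Q"
  unfolding bound_quiver_algebra_def quotient_def by (auto simp: image_iff)

lemma basis_vec_path_algebra: "p \<in> quiver_paths Q \<Longrightarrow> (basis_vec p :: ('x, 'c, 'k::field) path_alg) \<in> path_algebra Q"
  by (auto simp: path_algebra_def basis_vec_def)

lemma path_algebra_act_basis_vec: "path_algebra_act T F (basis_vec p) u = path_act T F p u"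
  for u :: "'v \<Rightarrow> 'k::field"
proof -
  have "{q. basis_vec p q \<noteq> (0 :: 'k)} = {p}" by (auto simp: basis_vec_def)
  thus ?thesis by (simp add: path_algebra_act_def) (simp add: basis_vec_def scale_def)
qed

lemma vertex_space_add: "u \<in> vertex_space T \<Longrightarrow> v \<in> vertex_space T \<Longrightarrow> u + v \<in> vertex_space T"
  and vertex_space_scale: "u \<in> vertex_space T \<Longrightarrow> scale c u \<in> vertex_space T"
  and vertex_space_zero: "0 \<in> vertex_space T"
  and vertex_space_basis: "n \<in> verts T \<Longrightarrow> basis_vec n \<in> vertex_space T"
  by (auto simp: vertex_space_def scale_def basis_vec_def)

text \<open>Here \<open>c (n, m)\<close> is the coordinate at \<open>m\<close> of the image of the
  basis vector of \<open>n\<close>. The value 0 outside of the vertex space is the normalisation in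
  \<open>module_homs\<close>.\<close>

definition matrix_map :: "('v, 'a) pre_digraph \<Rightarrow> ('v \<times> 'w \<Rightarrow> 'k::field) \<Rightarrow> ('v \<Rightarrow> 'k) \<Rightarrow> 'w \<Rightarrow> 'k" where
  "matrix_map T c v = (if v \<in> vertex_space T then linear_ext T (\<lambda>n m. c (n, m)) v else 0)"

lemma matrix_map_lin_comb:
  "matrix_map T (\<lambda>x. s * c x + t * c' x) = (\<lambda>v. scale s (matrix_map T c v)) + (\<lambda>v. scale t (matrix_map T c' v))"
  by (intro ext) (simp add: matrix_map_def linear_ext_apply scale_def algebra_simps sum.distrib sum_distrib_left)

context tree_pair
begin

section \<open>Commuting with the algebra as a system of equations\<close>

text \<open>Lower vertices correspond to arrows of the second tree, upper ones to arrows of the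
  first, since an arrow is determined by its tail. Pairs outside of the pullback network contribute
  0.\<close>

lemma equation_iff:
  fixes c :: "'v \<times> 'w \<Rightarrow> 'k::field"
  assumes supp: "supp c \<subseteq> verts N"
  shows "forest.solution c \<longleftrightarrow> (\<forall>n m \<gamma>.
    (\<Sum>b | b \<in> arcs T2 \<and> snd F2 b = \<gamma> \<and> head T2 b = m. c (n, tail T2 b))
    = (\<Sum>a | a \<in> arcs T1 \<and> snd F1 a = \<gamma> \<and> tail T1 a = n. c (head T1 a, m)))" (is "_ \<longleftrightarrow> (\<forall>n m \<gamma>. ?L n m \<gamma> = ?U n m \<gamma>)")
proof -
  have zero: "c x = 0" if "x \<notin> verts N" for x using supp that by (auto simp: supp_def)
  have "sum c (low (n, m, \<gamma>)) = ?L n m \<gamma>" for n m \<gamma>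
  proof -
    let ?B = "{b. b \<in> arcs T2 \<and> snd F2 b = \<gamma> \<and> head T2 b = m}"
    have "?L n m \<gamma> = sum c ((\<lambda>b. (n, tail T2 b)) ` ?B)"
      by (rule sum.reindex_cong[symmetric, of "\<lambda>b. (n, tail T2 b)"]) (auto simp: inj_on_def intro: out2)
    also have "\<dots> = sum c (low (n, m, \<gamma>))"
      by (rule sum.mono_neutral_right) (auto simp: low_def intro!: zero)
    finally show ?thesis ..
  qed
  moreover have "sum c (up (n, m, \<gamma>)) = ?U n m \<gamma>" for n m \<gamma>
  proof -
    let ?B = "{a. a \<in> arcs T1 \<and> snd F1 a = \<gamma> \<and> tail T1 a = n}"
    have "?U n m \<gamma> = sum c ((\<lambda>a. (head T1 a, m)) ` ?B)"
      by (rule sum.reindex_cong[symmetric, of "\<lambda>a. (head T1 a, m)"]) (auto simp: inj_on_def intro: out1)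
    also have "\<dots> = sum c (up (n, m, \<gamma>))"
      by (rule sum.mono_neutral_right) (auto simp: up_def intro!: zero)
    finally show ?thesis ..
  qed
  ultimately show ?thesis using supp by (auto simp: forest.solution_def)
qed

text \<open>Regrouping the arrows by tail instead of head exposes the right side of
  \<open>equation_iff\<close> as the coefficient of \<open>v n\<close>;
  \<open>arrow_act_linear_ext\<close> does the same for the left side.\<close>

lemma linear_ext_arrow_act:
  fixes c :: "'v \<times> 'w \<Rightarrow> 'k::field"
  shows "linear_ext T1 (\<lambda>n m. c (n, m)) (arrow_act T1 F1 \<gamma> v) m =
    (\<Sum>n\<in>verts T1. v n * (\<Sum>a | a \<in> arcs T1 \<and> snd F1 a = \<gamma> \<and> tail T1 a = n. c (head T1 a, m)))"
proof -
  let ?A = "{a \<in> arcs T1. snd F1 a = \<gamma>}"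
  have "linear_ext T1 (\<lambda>n m. c (n, m)) (arrow_act T1 F1 \<gamma> v) m
      = (\<Sum>n\<in>verts T1. \<Sum>a | a \<in> ?A \<and> head T1 a = n. v (tail T1 a) * c (head T1 a, m))"
    unfolding linear_ext_apply arrow_act_apply[OF T1.fin_digraph_axioms] sum_distrib_right
    by (intro sum.cong) auto
  also have "\<dots> = (\<Sum>a\<in>?A. v (tail T1 a) * c (head T1 a, m))"
    by (rule sum.group) auto
  also have "\<dots> = (\<Sum>n\<in>verts T1. \<Sum>a | a \<in> ?A \<and> tail T1 a = n. v (tail T1 a) * c (head T1 a, m))"
    by (rule sum.group[symmetric]) auto
  also have "\<dots> = (\<Sum>n\<in>verts T1. v n * (\<Sum>a | a \<in> arcs T1 \<and> snd F1 a = \<gamma> \<and> tail T1 a = n. c (head T1 a, m)))"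
    unfolding sum_distrib_left by (intro sum.cong) auto
  finally show ?thesis .
qed

lemma arrow_act_linear_ext:
  fixes c :: "'v \<times> 'w \<Rightarrow> 'k::field"
  shows "arrow_act T2 F2 \<gamma> (linear_ext T1 (\<lambda>n m. c (n, m)) v) m =
    (\<Sum>n\<in>verts T1. v n * (\<Sum>b | b \<in> arcs T2 \<and> snd F2 b = \<gamma> \<and> head T2 b = m. c (n, tail T2 b)))"
  unfolding linear_ext_apply arrow_act_apply[OF T2.fin_digraph_axioms] sum_distrib_left
  by (rule sum.swap)

text \<open>A nonzero entry joins only vertices with the same image in \<open>Q\<close>, so
  selecting the vertices over \<open>x\<close> before or after the map is the same.\<close>

lemma vertex_act_linear_ext:
  fixes c :: "'v \<times> 'w \<Rightarrow> 'k::field"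
  assumes "supp c \<subseteq> verts N"
  shows "linear_ext T1 (\<lambda>n m. c (n, m)) (vertex_act T1 F1 x v) = vertex_act T2 F2 x (linear_ext T1 (\<lambda>n m. c (n, m)) v)"
proof
  fix m
  have "(n, m) \<in> verts N" if "c (n, m) \<noteq> 0" for n using assms that by (auto simp: supp_def)
  hence *: "c (n, m) = 0 \<or> m \<in> verts T2 \<and> fst F1 n = fst F2 m" for n by (auto simp: N_simps)
  have "(if n \<in> verts T1 \<and> fst F1 n = x then v n else 0) * c (n, m)
      = (if m \<in> verts T2 \<and> fst F2 m = x then v n * c (n, m) else 0)" if "n \<in> verts T1" for n
    using that *[of n] by auto
  thus "linear_ext T1 (\<lambda>n m. c (n, m)) (vertex_act T1 F1 x v) m
      = vertex_act T2 F2 x (linear_ext T1 (\<lambda>n m. c (n, m)) v) m"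
    by (auto simp: linear_ext_apply vertex_act_apply intro!: sum.neutral)
qed

text \<open>Compatibility passes from arrows to paths by composition and from paths to the path
  algebra by linearity.\<close>

lemma path_algebra_act_linear_ext:
  fixes c :: "'v \<times> 'w \<Rightarrow> 'k::field"
  assumes c: "forest.solution c"
  shows "linear_ext T1 (\<lambda>n m. c (n, m)) (path_algebra_act T1 F1 g v)
    = path_algebra_act T2 F2 g (linear_ext T1 (\<lambda>n m. c (n, m)) v)"
proof -
  let ?h = "linear_ext T1 (\<lambda>n m. c (n, m))"
  have supp: "supp c \<subseteq> verts N" using c by (simp add: forest.solution_def)
  have arrow: "?h (arrow_act T1 F1 \<gamma> v) = arrow_act T2 F2 \<gamma> (?h v)" for \<gamma> v
    using c unfolding equation_iff[OF supp]
    by (intro ext) (simp add: linear_ext_arrow_act arrow_act_linear_ext)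
  have "?h (fold (arrow_act T1 F1) ps v) = fold (arrow_act T2 F2) ps (?h v)" for ps v
    by (induction ps arbitrary: v) (simp_all add: arrow)
  hence "?h (path_act T1 F1 p v) = path_act T2 F2 p (?h v)" for p
    by (simp add: path_act_def vertex_act_linear_ext[OF supp])
  thus ?thesis by (simp add: path_algebra_act_def linear_ext_sum linear_ext_scale)
qed

lemma matrix_map_module_hom:
  fixes c :: "'v \<times> 'w \<Rightarrow> 'k::field"
  assumes Q: "wf_digraph Q" and \<rho>: "\<rho> \<subseteq> quiver_paths Q"
    and F: "rooted_tree_over TYPE('k) Q \<rho> T1 F1" "rooted_tree_over TYPE('k) Q \<rho> T2 F2"
    and c: "forest.solution c"
  shows "matrix_map T1 c \<in> module_homs (bound_quiver_algebra Q \<rho>) (tree_module T1 F1) (tree_module T2 F2)"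
proof -
  have elts: "elts (tree_module T F) = vertex_space T" for T F by (simp add: tree_module_def)
  have "c (n, m) = 0" if "m \<notin> verts T2" for n m
    using c that by (auto simp: forest.solution_def supp_def N_simps)
  hence "matrix_map T1 c u \<in> vertex_space T2" for u
    by (simp add: matrix_map_def vertex_space_def linear_ext_apply)
  moreover have "matrix_map T1 c (lact (tree_module T1 F1) r u) = lact (tree_module T2 F2) r (matrix_map T1 c u)"
    if "r \<in> bound_quiver_algebra Q \<rho>" "u \<in> vertex_space T1" for r u
  proof -
    from that(1) obtain g where g: "g \<in> path_algebra Q" "r = {h \<in> path_algebra Q. g - h \<in> relation_ideal Q \<rho>}"
      unfolding bound_quiver_algebra_eq by blast
    show ?thesis
      using that(2) path_algebra_act_in_space[OF T1.fin_digraph_axioms, of F1 g u] path_algebra_act_linear_ext[OF c]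
      by (simp add: g(2) tree_module_act[OF Q \<rho> F(1) g(1)] tree_module_act[OF Q \<rho> F(2) g(1)] matrix_map_def)
  qed
  ultimately show ?thesis
    by (auto simp: module_homs_def elts vertex_space_add vertex_space_scale)
      (auto simp: matrix_map_def linear_ext_add linear_ext_scale vertex_space_add vertex_space_scale)
qed

text \<open>It is enough to test the homomorphism on cosets of paths: trivial paths confine the
  matrix to the pullback network, paths of length one give the equations.\<close>

lemma module_hom_matrix_map:
  fixes f :: "('v \<Rightarrow> 'k::field) \<Rightarrow> 'w \<Rightarrow> 'k"
  assumes Q: "wf_digraph Q" and \<rho>: "\<rho> \<subseteq> quiver_paths Q"
    and F: "rooted_tree_over TYPE('k) Q \<rho> T1 F1" "rooted_tree_over TYPE('k) Q \<rho> T2 F2"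
    and f: "f \<in> module_homs (bound_quiver_algebra Q \<rho>) (tree_module T1 F1) (tree_module T2 F2)"
  obtains c where "forest.solution c" "f = matrix_map T1 c"
proof
  have elts: "elts (tree_module T F) = vertex_space T" for T F by (simp add: tree_module_def)
  have f_scale: "f (scale s u) = scale s (f u)" if "u \<in> vertex_space T1" for u s
    using f that by (auto simp: module_homs_def elts)
  have f_add: "f (u + v) = f u + f v" if "u \<in> vertex_space T1" "v \<in> vertex_space T1" for u v
    using f that by (auto simp: module_homs_def elts)
  have f_path: "f (path_act T1 F1 p u) = path_act T2 F2 p (f u)"
    if p: "p \<in> quiver_paths Q" and u: "u \<in> vertex_space T1" for p u
  proof -
    let ?g = "basis_vec p :: ('x, 'c, 'k) path_alg"
    let ?r = "{h \<in> path_algebra Q. ?g - h \<in> relation_ideal Q \<rho>}"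
    note g = basis_vec_path_algebra[OF p, where ?'k = 'k]
    have "?r \<in> bound_quiver_algebra Q \<rho>" using g by (auto simp: bound_quiver_algebra_eq)
    hence "f (lact (tree_module T1 F1) ?r u) = lact (tree_module T2 F2) ?r (f u)"
      using f u unfolding module_homs_def elts by blast
    thus ?thesis
      unfolding tree_module_act[OF Q \<rho> F(1) g] tree_module_act[OF Q \<rho> F(2) g] path_algebra_act_basis_vec .
  qed
  define c where "c = (\<lambda>(n, m). if n \<in> verts T1 then f (basis_vec n) m else 0)"
  let ?h = "linear_ext T1 (\<lambda>n m. c (n, m))"
  have f_h: "f u = ?h u" if u: "u \<in> vertex_space T1" for u
  proof -
    \<comment> \<open>Membership is carried through the induction because \<open>f\<close> is
      additive only on the vertex space.\<close>
    have "(\<Sum>n\<in>A. scale (u n) (basis_vec n)) \<in> vertex_space T1 \<and>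
        f (\<Sum>n\<in>A. scale (u n) (basis_vec n)) = (\<Sum>n\<in>A. scale (u n) (f (basis_vec n)))"
      if "finite A" "A \<subseteq> verts T1" for A
      using that
    proof (induction A rule: finite_induct)
      case empty
      have "f (scale 0 0) = scale 0 (f 0)" by (intro f_scale vertex_space_zero)
      hence "f 0 = 0" by (simp add: scale_def zero_fun_def)
      thus ?case by (simp only: sum.empty vertex_space_zero simp_thms)
    next
      case (insert n A)
      hence "basis_vec n \<in> (vertex_space T1 :: ('v \<Rightarrow> 'k) set)" by (simp add: vertex_space_basis)
      with insert show ?case
        by (simp only: sum.insert insert_subset vertex_space_add vertex_space_scale f_add f_scale simp_thms)
    qed
    moreover have "u = (\<Sum>n\<in>verts T1. scale (u n) (basis_vec n))"
    proof
      fix n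
      have "(\<Sum>n'\<in>verts T1. scale (u n') (basis_vec n') n) = (\<Sum>n'\<in>verts T1. if n' = n then u n else 0)"
        by (rule sum.cong) (auto simp: scale_def basis_vec_def)
      thus "u n = (\<Sum>n\<in>verts T1. scale (u n) (basis_vec n)) n"
        using u by (simp add: sum_fun_apply vertex_space_def)
    qed
    ultimately have "f u = (\<Sum>n\<in>verts T1. scale (u n) (f (basis_vec n)))"
      using T1.finite_verts by (metis subset_refl)
    also have "\<dots> = ?h u" by (auto simp: linear_ext_def c_def intro!: sum.cong)
    finally show ?thesis .
  qed
  have basis: "basis_vec n \<in> (vertex_space T1 :: ('v \<Rightarrow> 'k) set)" if "n \<in> verts T1" for n
    using that by (rule vertex_space_basis)
  have fix1: "vertex_act T1 F1 (fst F1 n) (basis_vec n) = (basis_vec n :: 'v \<Rightarrow> 'k)" if "n \<in> verts T1" for n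
    using that by (intro ext) (auto simp: vertex_act_apply basis_vec_def)
  \<comment> \<open>The trivial path at the image of \<open>n\<close> fixes the basis vector, hence
    also its image under \<open>f\<close>.\<close>
  have fix2: "vertex_act T2 F2 (fst F1 n) (f (basis_vec n)) = f (basis_vec n)" if "n \<in> verts T1" for n
  proof -
    have "fst F1 n \<in> verts Q" using mor1 that by (simp add: quiver_morphism_def)
    hence "(fst F1 n, []) \<in> quiver_paths Q"
      by (auto simp: quiver_paths_def pre_digraph.awalk_def pre_digraph.cas.simps)
    from f_path[OF this basis[OF that]] show ?thesis by (simp add: path_act_def fix1 that)
  qed
  have supp: "supp c \<subseteq> verts N"
  proof
    fix x assume x: "x \<in> supp c"
    obtain n m where nm: "x = (n, m)" by (cases x)
    with x have n: "n \<in> verts T1" "f (basis_vec n) m \<noteq> 0" by (auto simp: supp_def c_def split: if_splits)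
    hence "vertex_act T2 F2 (fst F1 n) (f (basis_vec n)) m \<noteq> 0" by (simp add: fix2)
    thus "x \<in> verts N" using n by (auto simp: nm N_simps vertex_act_apply split: if_splits)
  qed
  have zero: "c x = 0" if "x \<notin> verts N" for x using supp that by (auto simp: supp_def)
  have "(\<Sum>b | b \<in> arcs T2 \<and> snd F2 b = \<gamma> \<and> head T2 b = m. c (n, tail T2 b))
    = (\<Sum>a | a \<in> arcs T1 \<and> snd F1 a = \<gamma> \<and> tail T1 a = n. c (head T1 a, m))" for n m \<gamma>
  proof (cases "n \<in> verts T1 \<and> \<gamma> \<in> arcs Q \<and> fst F1 n = tail Q \<gamma>")
    case True
    hence n: "n \<in> verts T1" by simp
    have "(fst F1 n, [\<gamma>]) \<in> quiver_paths Q"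
      using True Q by (auto simp: quiver_paths_def pre_digraph.awalk_def pre_digraph.cas.simps wf_digraph_def)
    from f_path[OF this basis[OF n]]
    have "f (arrow_act T1 F1 \<gamma> (basis_vec n)) = arrow_act T2 F2 \<gamma> (f (basis_vec n))"
      by (simp add: path_act_def fix1 fix2 n)
    moreover have "n' \<in> verts T1" if "arrow_act T1 F1 \<gamma> (basis_vec n) n' \<noteq> (0 :: 'k)" for n'
      using that by (rule arrow_act_nonzeroE) auto
    hence "arrow_act T1 F1 \<gamma> (basis_vec n) \<in> (vertex_space T1 :: ('v \<Rightarrow> 'k) set)"
      by (auto simp: vertex_space_def)
    ultimately have "?h (arrow_act T1 F1 \<gamma> (basis_vec n)) m = arrow_act T2 F2 \<gamma> (?h (basis_vec n)) m"
      using f_h basis[OF n] by metis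
    moreover have "(\<Sum>n'\<in>verts T1. basis_vec n n' * g n') = (g n :: 'k)" for g
    proof -
      have "(\<Sum>n'\<in>verts T1. basis_vec n n' * g n') = (\<Sum>n'\<in>verts T1. if n' = n then g n else 0)"
        by (rule sum.cong) (auto simp: basis_vec_def)
      thus ?thesis using n by simp
    qed
    ultimately show ?thesis by (simp add: linear_ext_arrow_act arrow_act_linear_ext)
  next
    \<comment> \<open>Here \<open>n\<close> is no vertex of the first tree or \<gamma> is no arrow
      of \<open>Q\<close> starting at its image, so all terms on the left vanish and no term occurs
      on the right.\<close>
    case False
    have "c (n, tail T2 b) = 0" if "b \<in> arcs T2" "snd F2 b = \<gamma>" for b
      using that False mor2 by (intro zero) (auto simp: N_simps quiver_morphism_def)
    hence L: "(\<Sum>b | b \<in> arcs T2 \<and> snd F2 b = \<gamma> \<and> head T2 b = m. c (n, tail T2 b)) = 0"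
      by (intro sum.neutral) auto
    have "{a. a \<in> arcs T1 \<and> snd F1 a = \<gamma> \<and> tail T1 a = n} = {}"
      using False mor1 by (auto simp: quiver_morphism_def)
    thus ?thesis unfolding L by (simp only: sum.empty)
  qed
  thus "forest.solution c" by (simp add: equation_iff[OF supp])
  show "f = matrix_map T1 c"
    using f f_h by (intro ext) (simp add: module_homs_def elts matrix_map_def)
qed


section \<open>The span of the generalized graph maps\<close>

lemma network_map_eq:
  assumes "subnetwork M N2"
  shows "network_map T1 M = (matrix_map T1 (coeff M) :: ('v \<Rightarrow> 'k::field) \<Rightarrow> 'w \<Rightarrow> 'k)"
proof -
  have "(\<Sum>(m, j) | (n, m, j) \<in> verts M. scale (of_int j) (basis_vec m)) m' = (coeff M (n, m') :: 'k)" for n m'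
  proof -
    let ?X = "{(m, j). (n, m, j) \<in> verts M}"
    have "?X \<subseteq> snd ` verts M" by force
    hence fin: "finite ?X" using finite_verts_subnetwork[OF assms] finite_surj by blast
    have "(\<Sum>(m, j)\<in>?X. scale (of_int j) (basis_vec m)) m'
        = (\<Sum>x\<in>?X. if fst x = m' then of_int (snd x) else 0 :: 'k)"
      by (auto simp: sum_fun_apply scale_def basis_vec_def intro!: sum.cong)
    also have "\<dots> = (\<Sum>x\<in>Pair m' ` {j. (n, m', j) \<in> verts M}. of_int (snd x))"
      by (rule sum.mono_neutral_cong_right[OF fin]) auto
    also have "\<dots> = coeff M (n, m')"
      by (simp add: coeff_def sum.reindex inj_on_def)
    finally show ?thesis .
  qed
  thus ?thesis by (intro ext) (simp add: network_map_def matrix_map_def linear_ext_apply)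
qed

text \<open>One inclusion is \<open>solution_induct\<close>, with support networks for the
  elementary solutions. For the other, generalized graph maps give solutions, and the maps of
  solutions form a subspace.\<close>

lemma matrix_map_span:
  assumes char: "(2 :: 'k::field) \<noteq> 0"
  shows "matrix_map T1 ` {c :: 'v \<times> 'w \<Rightarrow> 'k. forest.solution c} =
    module.span (\<lambda>(s :: 'k) f v. scale s (f v)) {network_map T1 G | G. generalized_graph_map T1 F1 T2 F2 G}"
    (is "?S = module.span _ ?G")
proof -
  interpret M: module "\<lambda>(s :: 'k) (f :: ('v \<Rightarrow> 'k) \<Rightarrow> 'w \<Rightarrow> 'k) v. scale s (f v)"
    by unfold_locales (simp_all add: scale_def fun_eq_iff distrib_left distrib_right)
  have lin: "matrix_map T1 (\<lambda>x. s * c x + t * c' x)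
      = (\<lambda>v. scale s (matrix_map T1 c v)) + (\<lambda>v. scale t (matrix_map T1 c' v))" for s t and c c' :: "'v \<times> 'w \<Rightarrow> 'k"
    by (rule matrix_map_lin_comb)
  have zero: "matrix_map T1 0 = (0 :: ('v \<Rightarrow> 'k) \<Rightarrow> 'w \<Rightarrow> 'k)"
    by (intro ext) (simp add: matrix_map_def linear_ext_apply)
  have one: "(\<lambda>v. scale 1 (f v)) = f" for f :: "('v \<Rightarrow> 'k) \<Rightarrow> 'w \<Rightarrow> 'k" by (rule M.scale_one)
  show ?thesis
  proof (intro equalityI subsetI)
    fix f assume "f \<in> ?S"
    then obtain c where c: "forest.solution c" and f: "f = matrix_map T1 c" by blast
    from c have "matrix_map T1 c \<in> M.span ?G"
    proof (induction c rule: forest.solution_induct)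
      case zero
      show ?case unfolding \<open>matrix_map T1 0 = 0\<close> by (rule M.span_zero)
    next
      case (add s e c)
      have "network_map T1 (support_network e) = matrix_map T1 e"
        by (simp add: network_map_eq[OF subnetwork_support_network] coeff_support_network[OF char add(1,2)])
      moreover have "generalized_graph_map T1 F1 T2 F2 (support_network e)"
        using char add(1,2) by (rule support_network_generalized_graph_map)
      ultimately have "matrix_map T1 e \<in> ?G" by (auto intro!: exI[of _ "support_network e"])
      hence "matrix_map T1 e \<in> M.span ?G" by (rule M.span_base)
      hence "(\<lambda>v. scale s (matrix_map T1 e v)) + matrix_map T1 c \<in> M.span ?G"
        using add(3) by (intro M.span_add M.span_scale)
      moreover have "matrix_map T1 (\<lambda>x. s * e x + c x) = (\<lambda>v. scale s (matrix_map T1 e v)) + matrix_map T1 c"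
        using lin[of s e 1 c] by (simp only: one mult_1_left)
      ultimately show ?case by (simp only:)
    qed
    thus "f \<in> M.span ?G" by (simp add: f)
  next
    have "?G \<subseteq> ?S"
      using generalized_graph_map_solution[OF char] network_map_eq
      by (force simp: generalized_graph_map_def)
    moreover have "M.subspace ?S"
      unfolding M.subspace_def
    proof (intro conjI ballI allI)
      show "0 \<in> ?S" using zero forest.solution_0 by (metis imageI mem_Collect_eq)
    next
      fix f g assume "f \<in> ?S" "g \<in> ?S"
      then obtain c d where cd: "forest.solution c" "forest.solution d" "f = matrix_map T1 c" "g = matrix_map T1 d" by blast
      have "f + g = matrix_map T1 (\<lambda>x. 1 * c x + 1 * d x)" unfolding cd(3,4) lin one ..
      moreover have "forest.solution (\<lambda>x. 1 * c x + 1 * d x)" using cd(1,2) by (rule forest.solution_lin_comb)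
      ultimately show "f + g \<in> ?S" by blast
    next
      fix s f assume "f \<in> ?S"
      then obtain c where c: "forest.solution c" "f = matrix_map T1 c" by blast
      \<comment> \<open>The term with coefficient 0 brings the scalar multiple into the shape of
        \<open>solution_lin_comb\<close>.\<close>
      have "(\<lambda>v. scale s (f v)) = matrix_map T1 (\<lambda>x. s * c x + 0 * c x)"
        unfolding c(2) lin by (intro ext) (simp add: scale_def)
      moreover have "forest.solution (\<lambda>x. s * c x + 0 * c x)" using c(1) c(1) by (rule forest.solution_lin_comb)
      ultimately show "(\<lambda>v. scale s (f v)) \<in> ?S" by blast
    qed
    ultimately have "M.span ?G \<subseteq> ?S" by (rule M.span_minimal)
    thus "f \<in> M.span ?G \<Longrightarrow> f \<in> ?S" for f by blast
  qed
qed

end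

theorem corollary2p25:
  fixes Q :: "('x, 'c) pre_digraph" and \<rho> :: "('x, 'c) path set"
    and T1 :: "('v, 'a) pre_digraph" and F1 :: "('v \<Rightarrow> 'x) \<times> ('a \<Rightarrow> 'c)"
    and T2 :: "('w, 'b) pre_digraph" and F2 :: "('w \<Rightarrow> 'x) \<times> ('b \<Rightarrow> 'c)"
  assumes "CHAR('k::field) \<noteq> 2"
    and "wf_digraph Q" and "relation_set TYPE('k) Q \<rho>"
    and "rooted_tree_over TYPE('k) Q \<rho> T1 F1"
    and "rooted_tree_over TYPE('k) Q \<rho> T2 F2"
  shows "module_homs (bound_quiver_algebra Q \<rho>) (tree_module T1 F1) (tree_module T2 F2) =
    module.span (\<lambda>(c :: 'k) f v. scale c (f v))
      {network_map T1 G | G. generalized_graph_map T1 F1 T2 F2 G}"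
proof -
  \<comment> \<open>If 2 were 0, the characteristic would divide 2 without being 2, hence be 1,
    which a field excludes.\<close>
  have char: "(2 :: 'k) \<noteq> 0"
  proof
    assume "(2 :: 'k) = 0"
    hence "of_nat 2 = (0 :: 'k)" by simp
    hence dvd: "CHAR('k) dvd 2" by (simp only: of_nat_eq_0_iff_char_dvd)
    hence "CHAR('k) \<le> 2" by (rule dvd_imp_le) simp
    with assms(1) have "CHAR('k) = 0 \<or> CHAR('k) = 1" by linarith
    with dvd show False by auto
  qed
  have T: "rooted_tree T1" "rooted_tree T2" and mor: "quiver_morphism T1 Q F1" "quiver_morphism T2 Q F2"
    using assms(4,5) by (auto simp: rooted_tree_over_def bound_morphism_def)
  hence qt: "quiver_tree T1" "quiver_tree T2" by (auto simp: rooted_tree_def)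
  obtain rank :: "'w \<Rightarrow> nat" where rank: "\<And>b. b \<in> arcs T2 \<Longrightarrow> rank (head T2 b) < rank (tail T2 b)"
    using quiver_tree_rank[OF qt(2)] by metis
  interpret fin_digraph T1 using qt by (simp add: quiver_tree_def)
  interpret T2: fin_digraph T2 using qt by (simp add: quiver_tree_def)
  interpret tree_pair T1 T2 Q F1 F2 rank
  proof
    show "quiver_morphism T1 Q F1" "quiver_morphism T2 Q F2" by (rule mor)+
    show "a = a'" if "a \<in> arcs T1" "a' \<in> arcs T1" "tail T1 a = tail T1 a'" for a a'
      using that by (rule rooted_tree_out_arc_unique[OF T(1)])
    show "b = b'" if "b \<in> arcs T2" "b' \<in> arcs T2" "tail T2 b = tail T2 b'" for b b'
      using that by (rule rooted_tree_out_arc_unique[OF T(2)])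
  qed (rule rank)
  have \<rho>: "\<rho> \<subseteq> quiver_paths Q" using assms(3) by (simp add: relation_set_def)
  have "module_homs (bound_quiver_algebra Q \<rho>) (tree_module T1 F1) (tree_module T2 F2)
      = matrix_map T1 ` {c :: 'v \<times> 'w \<Rightarrow> 'k. forest.solution c}"
    using matrix_map_module_hom[OF assms(2) \<rho> assms(4,5)] module_hom_matrix_map[OF assms(2) \<rho> assms(4,5)]
    by blast
  also note matrix_map_span[OF char]
  finally show ?thesis .
qed

end
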